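(* Let $f$ be a $C^2$ function on $\mathcal{M}$, and let $\mathcal{E}_\zeta(f)=(f,\Delta_\zeta f)_h=\int_{\mathcal{M}}f\,\Delta_\zeta f\,\nu$ be the Dirichlet form associated with the cone-kernel diffusion operator $\Delta_\zeta$. Then, as $\zeta\to1$ with $\zeta\in[0,1)$, $$\mathcal{E}_\zeta(f)=(1-\zeta)^{-1/2}\,\bar{\mathcal{E}}(f)+O\big((1-\zeta)^{1/2}\big),\qquad \bar{\mathcal{E}}(f)=\int_{\mathcal{M}}[v(f)]^2\,\bar\nu .$$
   Context: Setting: $\mathcal{M}$ is a smooth compact $m$-dimensional manifold without boundary, carrying a nowhere-vanishing vector field $v$ of class at least $C^1$ (the dynamical vector field of a flow on $\mathcal{M}$); $v(f)$ denotes the directional derivative of $f$ along $v$. $F:\mathcal{M}\to\mathbb{R}^n$ is a $C^2$ embedding, $\mathbb{R}^n$ carries an inner product $(\cdot,\cdot)$, and $g(u,u')=(DF\,u,DF\,u')$ is the induced Riemannian metric on $\mathcal{M}$, with volume form $\mu$ and $\|v\|_g=\sqrt{g(v,v)}$. For $\zeta\in[0,1)$, the Riemannian metric associated with cone kernels is $$h=\frac{1}{\|v\|_g^2}\left(g-\zeta\,\frac{v^*\otimes v^*}{\|v\|_g^2}\right),\qquad v^*=g(v,\cdot),$$ with volume form $\nu=(1-\zeta)^{1/2}\bar\nu$, $\bar\nu=\mu/\|v\|_g^m$. The diffusion operator is $\Delta_\zeta=\delta_\zeta d$, where $\delta_\zeta$ is the codifferential of $h$, i.e. $\int_{\mathcal{M}}h^{-1}(w,df)\,\nu=\int_{\mathcal{M}}(\delta_\zeta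 w)f\,\nu$ for 1-forms $w$ and smooth functions $f$, with $h^{-1}$ the inverse metric on 1-forms (so $\Delta_\zeta$ is positive semidefinite). *)

theory Defs
  imports "HOL-Analysis.Analysis" "HOL-Library.Landau_Symbols"
begin

text \<open>
  The manifold is the whole type \<open>'a\<close> (Hausdorff, second countable), with a smooth structure given by
  an arbitrary smooth atlas \<open>A\<close>. A chart \<open>(U, \<phi>)\<close> is a homeomorphism of an open set \<open>U\<close> onto an open
  subset of \<open>real^'m\<close>; values of \<open>\<phi>\<close> off \<open>U\<close> are irrelevant. The dimension is \<open>CARD('m)\<close>; the
  well-order on the index type (needed for the change of variables formula in the library) only
  numbers the coordinates.
\<close>

section \<open>Differentiability classes on open sets\<close>

text \<open>Only meant for open \<open>S\<close>.\<close>

primrec Ck_on :: "nat \<Rightarrow> ('a::real_normed_vector \<Rightarrow> 'b::real_normed_vector) \<Rightarrow> 'a set \<Rightarrow> bool" where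
  "Ck_on 0 f S \<longleftrightarrow> continuous_on S f"
| "Ck_on (Suc k) f S \<longleftrightarrow> (\<forall>x\<in>S. f differentiable (at x)) \<and>
     (\<forall>v. Ck_on k (\<lambda>x. frechet_derivative f (at x) v) S)"

section \<open>Smooth manifolds\<close>

type_synonym ('a, 'm) chart = "'a set \<times> ('a \<Rightarrow> real^'m)"

definition chart_inv :: "('a, 'm) chart \<Rightarrow> real^'m \<Rightarrow> 'a" where
  "chart_inv c = inv_into (fst c) (snd c)"

definition smooth_atlas :: "('a::topological_space, 'm::finite) chart set \<Rightarrow> bool" where
  "smooth_atlas A \<longleftrightarrow>
     (\<forall>c\<in>A. open (fst c) \<and> open (snd c ` fst c) \<and>
        homeomorphism (fst c) (snd c ` fst c) (snd c) (chart_inv c)) \<and>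
     (\<Union>c\<in>A. fst c) = UNIV \<and>
     (\<forall>c\<in>A. \<forall>c'\<in>A. \<forall>k. Ck_on k (snd c' \<circ> chart_inv c) (snd c ` (fst c \<inter> fst c')))"

definition Ck_map :: "('a, 'm::finite) chart set \<Rightarrow> nat \<Rightarrow> ('a \<Rightarrow> 'b::real_normed_vector) \<Rightarrow> bool" where
  "Ck_map A k f \<longleftrightarrow> (\<forall>c\<in>A. Ck_on k (f \<circ> chart_inv c) (snd c ` fst c))"

definition smooth_map :: "('a, 'm::finite) chart set \<Rightarrow> ('a \<Rightarrow> 'b::real_normed_vector) \<Rightarrow> bool" where
  "smooth_map A f \<longleftrightarrow> (\<forall>k. Ck_map A k f)"

section \<open>Tangent vectors and vector fields\<close>

text \<open>
  A tangent vector at \<open>p\<close> is the family of its coordinate vectors in all charts around \<open>p\<close>, related by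
  the Jacobians of the transition maps. The entries for all other charts are set to \<open>0\<close>, so that
  equality of tangent vectors is equality of families.
\<close>

type_synonym ('a, 'm) tvec = "('a, 'm) chart \<Rightarrow> real^'m"

definition transition_deriv ::
    "('a, 'm::finite) chart \<Rightarrow> ('a, 'm) chart \<Rightarrow> 'a \<Rightarrow> real^'m \<Rightarrow> real^'m" where
  "transition_deriv c c' p = frechet_derivative (snd c' \<circ> chart_inv c) (at (snd c p))"

definition tangent_space :: "('a, 'm::finite) chart set \<Rightarrow> 'a \<Rightarrow> ('a, 'm) tvec set" where
  "tangent_space A p = {u.
     (\<forall>c\<in>A. \<forall>c'\<in>A. p \<in> fst c \<longrightarrow> p \<in> fst c' \<longrightarrow> u c' = transition_deriv c c' p (u c)) \<and>
     (\<forall>c. \<not> (c \<in> A \<and> p \<in> fst c) \<longrightarrow> u c = 0)}"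

definition coord_vec :: "('a, 'm::finite) chart set \<Rightarrow> ('a, 'm) chart \<Rightarrow> 'a \<Rightarrow> 'm \<Rightarrow> ('a, 'm) tvec" where
  "coord_vec A c p i =
     (\<lambda>c'. if c' \<in> A \<and> p \<in> fst c' then transition_deriv c c' p (axis i 1) else 0)"

definition Ck_vector_field ::
    "('a, 'm::finite) chart set \<Rightarrow> nat \<Rightarrow> ('a \<Rightarrow> ('a, 'm) tvec) \<Rightarrow> bool" where
  "Ck_vector_field A k v \<longleftrightarrow> (\<forall>p. v p \<in> tangent_space A p) \<and>
     (\<forall>c\<in>A. Ck_on k (\<lambda>x. v (chart_inv c x) c) (snd c ` fst c))"

text \<open>On tangent vectors the differential does not depend on the chart picked by \<open>SOME\<close>.\<close>

definition differential ::
    "('a, 'm::finite) chart set \<Rightarrow> ('a \<Rightarrow> 'b::real_normed_vector) \<Rightarrow> 'a \<Rightarrow> ('a, 'm) tvec \<Rightarrow> 'b" where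
  "differential A f p u = (let c = (SOME c. c \<in> A \<and> p \<in> fst c)
     in frechet_derivative (f \<circ> chart_inv c) (at (snd c p)) (u c))"

definition dir_deriv ::
    "('a, 'm::finite) chart set \<Rightarrow> ('a \<Rightarrow> ('a, 'm) tvec) \<Rightarrow> ('a \<Rightarrow> real) \<Rightarrow> 'a \<Rightarrow> real" where
  "dir_deriv A v f p = differential A f p (v p)"

definition Ck_embedding ::
    "('a::topological_space, 'm::finite) chart set \<Rightarrow> nat \<Rightarrow> ('a \<Rightarrow> 'b::real_normed_vector) \<Rightarrow> bool" where
  "Ck_embedding A k F \<longleftrightarrow> Ck_map A k F \<and>
     (\<forall>p. inj_on (differential A F p) (tangent_space A p)) \<and>
     (\<exists>G. homeomorphism UNIV (range F) F G)"

section \<open>Riemannian metrics\<close>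

definition is_inner_product :: "('b::real_vector \<Rightarrow> 'b \<Rightarrow> real) \<Rightarrow> bool" where
  "is_inner_product ip \<longleftrightarrow> bilinear ip \<and> (\<forall>x y. ip x y = ip y x) \<and> (\<forall>x. x \<noteq> 0 \<longrightarrow> ip x x > 0)"

type_synonym ('a, 'm) metric = "'a \<Rightarrow> ('a, 'm) tvec \<Rightarrow> ('a, 'm) tvec \<Rightarrow> real"

type_synonym ('a, 'm) one_form = "'a \<Rightarrow> ('a, 'm) tvec \<Rightarrow> real"

definition metric_matrix ::
    "('a, 'm::finite) chart set \<Rightarrow> ('a, 'm) metric \<Rightarrow> ('a, 'm) chart \<Rightarrow> 'a \<Rightarrow> real^'m^'m" where
  "metric_matrix A h c p = (\<chi> i j. h p (coord_vec A c p i) (coord_vec A c p j))"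

text \<open>
  The volume form enters only through integration of functions, so it is rendered as the Riemannian
  volume measure, which does not require an orientation.
\<close>

definition volume_measure ::
    "('a::topological_space, 'm::finite) chart set \<Rightarrow> ('a, 'm) metric \<Rightarrow> 'a measure" where
  "volume_measure A h = (THE M. sets M = sets borel \<and>
     (\<forall>c\<in>A. \<forall>B\<in>sets borel. B \<subseteq> fst c \<longrightarrow>
        emeasure M B =
          (\<integral>\<^sup>+x\<in>snd c ` B. ennreal (sqrt (det (metric_matrix A h c (chart_inv c x)))) \<partial>lborel)))"

definition sharp ::
    "('a, 'm::finite) chart set \<Rightarrow> ('a, 'm) metric \<Rightarrow> 'a \<Rightarrow> (('a, 'm) tvec \<Rightarrow> real) \<Rightarrow> ('a, 'm) tvec" where
  "sharp A h p \<alpha> =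
     (THE u. u \<in> tangent_space A p \<and> (\<forall>u'\<in>tangent_space A p. h p u u' = \<alpha> u'))"

definition inverse_metric ::
    "('a, 'm::finite) chart set \<Rightarrow> ('a, 'm) metric \<Rightarrow> 'a \<Rightarrow>
       (('a, 'm) tvec \<Rightarrow> real) \<Rightarrow> (('a, 'm) tvec \<Rightarrow> real) \<Rightarrow> real" where
  "inverse_metric A h p \<alpha> \<beta> = h p (sharp A h p \<alpha>) (sharp A h p \<beta>)"

text \<open>Continuity singles out one representative of the codifferential, which the duality alone
  determines only up to null sets.\<close>

definition codifferential ::
    "('a::topological_space, 'm::finite) chart set \<Rightarrow> ('a, 'm) metric \<Rightarrow> ('a, 'm) one_form \<Rightarrow> 'a \<Rightarrow> real"
    where
  "codifferential A h w = (THE d. continuous_on UNIV d \<and>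
     (\<forall>f. smooth_map A f \<longrightarrow>
        (\<integral>p. inverse_metric A h p (w p) (differential A f p) \<partial>volume_measure A h) =
        (\<integral>p. d p * f p \<partial>volume_measure A h)))"

definition laplacian ::
    "('a::topological_space, 'm::finite) chart set \<Rightarrow> ('a, 'm) metric \<Rightarrow> ('a \<Rightarrow> real) \<Rightarrow> 'a \<Rightarrow> real" where
  "laplacian A h f = codifferential A h (differential A f)"

definition dirichlet_form ::
    "('a::topological_space, 'm::finite) chart set \<Rightarrow> ('a, 'm) metric \<Rightarrow> ('a \<Rightarrow> real) \<Rightarrow> real" where
  "dirichlet_form A h f = (\<integral>p. f p * laplacian A h f p \<partial>volume_measure A h)"

section \<open>The metric of cone kernels\<close>

definition induced_metric ::
    "('a, 'm::finite) chart set \<Rightarrow> ('b::real_normed_vector \<Rightarrow> 'b \<Rightarrow> real) \<Rightarrow> ('a \<Rightarrow> 'b) \<Rightarrow> ('a, 'm) metric"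
    where
  "induced_metric A ip F p u u' = ip (differential A F p u) (differential A F p u')"

definition metric_norm :: "('a, 'm::finite) metric \<Rightarrow> ('a \<Rightarrow> ('a, 'm) tvec) \<Rightarrow> 'a \<Rightarrow> real" where
  "metric_norm g v p = sqrt (g p (v p) (v p))"

definition dual_form :: "('a, 'm::finite) metric \<Rightarrow> ('a \<Rightarrow> ('a, 'm) tvec) \<Rightarrow> ('a, 'm) one_form" where
  "dual_form g v p u = g p (v p) u"

definition cone_metric ::
    "('a, 'm::finite) metric \<Rightarrow> ('a \<Rightarrow> ('a, 'm) tvec) \<Rightarrow> real \<Rightarrow> ('a, 'm) metric" where
  "cone_metric g v \<zeta> p u u' =
     1 / (metric_norm g v p)\<^sup>2 *
       (g p u u' - \<zeta> * (dual_form g v p u * dual_form g v p u' / (metric_norm g v p)\<^sup>2))"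

definition nu_bar ::
    "('a::topological_space, 'm::finite) chart set \<Rightarrow> ('a, 'm) metric \<Rightarrow>
       ('a \<Rightarrow> ('a, 'm) tvec) \<Rightarrow> 'a measure" where
  "nu_bar A g v =
     density (volume_measure A g) (\<lambda>p. ennreal (1 / metric_norm g v p ^ CARD('m)))"

definition limit_dirichlet_form ::
    "('a::topological_space, 'm::finite) chart set \<Rightarrow> ('a, 'm) metric \<Rightarrow>
       ('a \<Rightarrow> ('a, 'm) tvec) \<Rightarrow> ('a \<Rightarrow> real) \<Rightarrow> real" where
  "limit_dirichlet_form A g v f = (\<integral>p. (dir_deriv A v f p)\<^sup>2 \<partial>nu_bar A g v)"

end

theory Submission
  imports Defs
begin

text \<open>
  The expansion in the theorem is an exact identity with two terms. Split every tangent space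
  \<open>g\<close>-orthogonally into the line of \<open>v\<close> and its complement. The cone metric \<open>h\<close> is
  \<open>g / \<parallel>v\<parallel>\<^sup>2\<close> with the part along \<open>v\<close> multiplied by \<open>1 - \<zeta>\<close>. Hence its inverse on
  \<open>df\<close> is \<open>\<parallel>v\<parallel>\<^sup>2 g\<^sup>-\<^sup>1(df, df) - (v f)\<^sup>2 + (v f)\<^sup>2 / (1 - \<zeta>)\<close>
  (\<open>inverse_metric_cone\<close>), while its volume density is that of \<open>g\<close> times
  \<open>(1 - \<zeta>)\<^bsup>1/2\<^esup> / \<parallel>v\<parallel>\<^sup>m\<close> by the matrix determinant lemma (\<open>vol_density_cone\<close>).
  Integrating, the last summand contributes exactly \<open>(1 - \<zeta>)\<^bsup>-1/2\<^esup>\<close> times the limit form, and the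
  two others contribute \<open>(1 - \<zeta>)\<^bsup>1/2\<^esup>\<close> times a constant independent of \<open>\<zeta>\<close>
  (\<open>dirichlet_form_cone\<close>).

  This computation presupposes that the Dirichlet form \<open>\<integral> f \<Delta>f\<close> equals the energy
  \<open>\<integral> h\<^sup>-\<^sup>1(df, df)\<close> (\<open>dirichlet_form_eq\<close>). The metric is only \<open>C\<^sup>1\<close> and \<open>f\<close> only
  \<open>C\<^sup>2\<close>, whereas the codifferential is characterised by testing against smooth functions. Two facts
  close the gap. For a \<open>C\<^sup>1\<close> one-form a continuous codifferential is constructed whose duality
  already holds for all \<open>C\<^sup>1\<close> test functions (\<open>codifferential_exists\<close>): a partition of unity
  reduces this to one chart, where it is the divergence theorem for compactly supported fields, and
  that one follows from translation invariance of Lebesgue measure (\<open>integral_derivative_zero\<close>).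
  Smooth bump functions determine a continuous function from its integrals against them
  (\<open>smooth_test_functions_separate\<close>), so the function constructed is the codifferential.

  The Riemannian volume measure is likewise given by a description only. It is obtained by gluing the
  measures \<open>sqrt (det h) dx\<close> of a sequence of charts along a disjoint Borel decomposition; they
  agree on overlaps by the change of variables formula (\<open>chart_volume_agree\<close>).
\<close>

section \<open>Calculus of functions of class \<open>C\<^sup>k\<close>\<close>

lemma Ck_on_cong:
  assumes "open S" "\<And>x. x \<in> S \<Longrightarrow> f x = g x" "Ck_on k f S"
  shows "Ck_on k g S"
  using assms(2,3)
proof (induction k arbitrary: f g)
  case 0
  then show ?case using continuous_on_cong by fastforce
next
  case (Suc k)
  have "(g has_derivative frechet_derivative f (at x)) (at x)" if "x \<in> S" for x
  proof -
    have "(f has_derivative frechet_derivative f (at x)) (at x)"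
      using Suc.prems(2) that by (simp add: frechet_derivative_works)
    then show ?thesis
      using has_derivative_transform_within_open[OF _ assms(1) that] Suc.prems(1) by blast
  qed
  note * = this
  have eq: "frechet_derivative f (at x) = frechet_derivative g (at x)" if "x \<in> S" for x
    using *[OF that] frechet_derivative_at by blast
  show ?case
    using Suc.prems(2) Suc.IH[of "\<lambda>x. frechet_derivative f (at x) u" "\<lambda>x. frechet_derivative g (at x) u" for u] * eq
    by (auto simp: differentiable_def)
qed

lemma Ck_on_subset: "Ck_on k f S \<Longrightarrow> T \<subseteq> S \<Longrightarrow> Ck_on k f T"
  by (induction k arbitrary: f) (auto intro: continuous_on_subset)

lemma Ck_on_Un:
  "open S \<Longrightarrow> open T \<Longrightarrow> Ck_on k f S \<Longrightarrow> Ck_on k f T \<Longrightarrow> Ck_on k f (S \<union> T)"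
  by (induction k arbitrary: f) (auto intro: continuous_on_open_Un)

lemma Ck_on_SucD: "Ck_on (Suc k) f S \<Longrightarrow> Ck_on k f S"
proof (induction k arbitrary: f)
  case 0
  then show ?case
    by (auto intro!: continuous_at_imp_continuous_on differentiable_imp_continuous_within)
qed auto

lemma Ck_on_le: "Ck_on k f S \<Longrightarrow> j \<le> k \<Longrightarrow> Ck_on j f S"
  by (induction k) (metis le_zero_eq, metis Ck_on_SucD le_Suc_eq)

lemma Ck_on_imp_continuous: "Ck_on k f S \<Longrightarrow> continuous_on S f"
  using Ck_on_le[of k f S 0] by simp

lemma Ck_on_has_derivative:
  "Ck_on (Suc k) f S \<Longrightarrow> x \<in> S \<Longrightarrow> (f has_derivative frechet_derivative f (at x)) (at x)"
  by (simp add: frechet_derivative_works)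

text \<open>To establish differentiability of the next order it is enough to exhibit some candidate for the
  derivative; uniqueness of derivatives on open sets identifies it with the chosen one. The closure
  properties below are all inductions through this rule.\<close>

lemma Ck_on_SucI:
  assumes "open S" "\<And>x. x \<in> S \<Longrightarrow> (f has_derivative f' x) (at x)"
    and "\<And>u. Ck_on k (\<lambda>x. f' x u) S"
  shows "Ck_on (Suc k) f S"
proof -
  have eq: "f' x = frechet_derivative f (at x)" if "x \<in> S" for x
    using assms(2)[OF that] frechet_derivative_at by blast
  show ?thesis
    using assms eq Ck_on_cong[OF assms(1) _ assms(3)] by (auto simp: differentiable_def)
qed

lemma Ck_on_const: "Ck_on k (\<lambda>x. c) S"
  by (induction k arbitrary: c) auto

lemma Ck_on_bounded_linear:
  assumes "bounded_linear L" "open S" "Ck_on k f S"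
  shows "Ck_on k (\<lambda>x. L (f x)) S"
  using assms(3)
proof (induction k arbitrary: f)
  case 0
  then show ?case
    using linear_continuous_on[OF assms(1)]
    by (auto intro: continuous_on_compose2[of UNIV L])
next
  case (Suc k)
  show ?case
  proof (rule Ck_on_SucI[OF assms(2)])
    show "((\<lambda>x. L (f x)) has_derivative (\<lambda>u. L (frechet_derivative f (at x) u))) (at x)"
      if "x \<in> S" for x
      using bounded_linear.has_derivative[OF assms(1) Ck_on_has_derivative[OF Suc.prems that]] .
    show "Ck_on k (\<lambda>x. L (frechet_derivative f (at x) u)) S" for u
      using Suc by auto
  qed
qed

lemma Ck_on_add:
  assumes "open S" "Ck_on k f S" "Ck_on k g S"
  shows "Ck_on k (\<lambda>x. f x + g x) S"
  using assms(2,3)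
proof (induction k arbitrary: f g)
  case 0
  then show ?case by (auto intro: continuous_on_add)
next
  case (Suc k)
  show ?case
  proof (rule Ck_on_SucI[OF assms(1)])
    show "((\<lambda>x. f x + g x) has_derivative
        (\<lambda>u. frechet_derivative f (at x) u + frechet_derivative g (at x) u)) (at x)"
      if "x \<in> S" for x
      using that Suc.prems by (intro has_derivative_add Ck_on_has_derivative)
    show "Ck_on k (\<lambda>x. frechet_derivative f (at x) u + frechet_derivative g (at x) u) S" for u
      using Suc by auto
  qed
qed

lemma Ck_on_sum:
  assumes "open S" "\<And>i. i \<in> I \<Longrightarrow> Ck_on k (f i) S"
  shows "Ck_on k (\<lambda>x. \<Sum>i\<in>I. f i x) S"
  using assms(2)
  by (induction I rule: infinite_finite_induct) (auto intro: Ck_on_const Ck_on_add[OF assms(1)])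

lemma Ck_on_bilinear:
  fixes P :: "'b::real_normed_vector \<Rightarrow> 'c::real_normed_vector \<Rightarrow> 'd::real_normed_vector"
  assumes "bounded_bilinear P" "open S" "Ck_on k f S" "Ck_on k g S"
  shows "Ck_on k (\<lambda>x. P (f x) (g x)) S"
  using assms(3,4)
proof (induction k arbitrary: f g)
  case 0
  then show ?case by (auto intro: bounded_bilinear.continuous_on[OF assms(1)])
next
  case (Suc k)
  show ?case
  proof (rule Ck_on_SucI[OF assms(2)])
    show "((\<lambda>x. P (f x) (g x)) has_derivative
        (\<lambda>u. P (f x) (frechet_derivative g (at x) u) + P (frechet_derivative f (at x) u) (g x))) (at x)"
      if "x \<in> S" for x
      using that Suc.prems by (intro bounded_bilinear.FDERIV[OF assms(1)] Ck_on_has_derivative)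
    show "Ck_on k (\<lambda>x. P (f x) (frechet_derivative g (at x) u) +
        P (frechet_derivative f (at x) u) (g x)) S" for u
      using Suc Ck_on_SucD[OF Suc.prems(1)] Ck_on_SucD[OF Suc.prems(2)]
      by (intro Ck_on_add[OF assms(2)] Suc.IH) auto
  qed
qed

lemmas Ck_on_mult = Ck_on_bilinear[OF bounded_bilinear_mult]
lemmas Ck_on_scaleR = Ck_on_bilinear[OF bounded_bilinear_scaleR]
lemmas Ck_on_inner = Ck_on_bilinear[OF bounded_bilinear_inner]

lemma Ck_on_ident: "open S \<Longrightarrow> Ck_on k (\<lambda>x. x) S"
proof (cases k)
  case (Suc j)
  assume "open S"
  then show ?thesis unfolding Suc
    by (rule Ck_on_SucI[where f'="\<lambda>x u. u"]) (auto intro: Ck_on_const derivative_eq_intros)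
qed simp

lemma Ck_on_minus:
  "open S \<Longrightarrow> Ck_on k f S \<Longrightarrow> Ck_on k (\<lambda>x. - f x) S"
  by (rule Ck_on_bounded_linear[OF bounded_linear_minus[OF bounded_linear_ident]])

lemma Ck_on_diff:
  "open S \<Longrightarrow> Ck_on k f S \<Longrightarrow> Ck_on k g S \<Longrightarrow> Ck_on k (\<lambda>x. f x - g x) S"
  using Ck_on_add[of S k f "\<lambda>x. - g x"] Ck_on_minus[of S k g] by simp

lemma Ck_on_prod:
  fixes f :: "'i \<Rightarrow> 'a::real_normed_vector \<Rightarrow> 'b::real_normed_field"
  assumes "open S" "\<And>i. i \<in> I \<Longrightarrow> Ck_on k (f i) S"
  shows "Ck_on k (\<lambda>x. \<Prod>i\<in>I. f i x) S"
  using assms(2)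
  by (induction I rule: infinite_finite_induct) (auto intro: Ck_on_const Ck_on_mult[OF assms(1)])

text \<open>In finite dimensions the directional form of the definition controls the full derivative, so
  the chain rule expands the inner derivative in an orthonormal basis.\<close>

lemma Ck_on_compose:
  fixes f :: "'a::real_normed_vector \<Rightarrow> 'b::euclidean_space" and g :: "'b \<Rightarrow> 'c::real_normed_vector"
  assumes "open S" "open T" "f ` S \<subseteq> T" "Ck_on k f S" "Ck_on k g T"
  shows "Ck_on k (\<lambda>x. g (f x)) S"
  using assms(4,5)
proof (induction k arbitrary: g)
  case 0
  then show ?case using assms(3) by (auto intro: continuous_on_compose2)
next
  case (Suc k)
  let ?Df = "\<lambda>x. frechet_derivative f (at x)" and ?Dg = "\<lambda>y. frechet_derivative g (at y)"
  let ?D = "\<lambda>x u. \<Sum>b\<in>Basis. (?Df x u \<bullet> b) *\<^sub>R ?Dg (f x) b"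
  show ?case
  proof (rule Ck_on_SucI[OF assms(1)])
    fix x assume x: "x \<in> S"
    have g: "(g has_derivative ?Dg (f x)) (at (f x))"
      using Suc.prems x assms(3) by (intro Ck_on_has_derivative) auto
    have f: "(f has_derivative ?Df x) (at x)" using Ck_on_has_derivative[OF Suc.prems(1) x] .
    interpret Dg: bounded_linear "?Dg (f x)" using g has_derivative_bounded_linear by blast
    have "?Dg (f x) (?Df x u) = ?D x u" for u
      by (subst euclidean_representation[of "?Df x u", symmetric]) (simp only: Dg.sum Dg.scaleR)
    then show "((\<lambda>x. g (f x)) has_derivative ?D x) (at x)"
      using has_derivative_compose[OF f g] by simp
  next
    fix u
    show "Ck_on k (\<lambda>x. ?D x u) S"
    proof (intro Ck_on_sum Ck_on_scaleR Ck_on_inner assms(1) Ck_on_const)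
      show "Ck_on k (\<lambda>x. ?Df x u) S" using Suc.prems by auto
      show "Ck_on k (\<lambda>x. ?Dg (f x) b) S" for b
        using Suc.IH[of "\<lambda>y. ?Dg y b"] Suc.prems Ck_on_SucD by auto
    qed
  qed
qed

lemma Ck_on_inverse:
  fixes f :: "'a::real_normed_vector \<Rightarrow> real"
  assumes "open S" "Ck_on k f S" "\<And>x. x \<in> S \<Longrightarrow> f x \<noteq> 0"
  shows "Ck_on k (\<lambda>x. inverse (f x)) S"
  using assms(2)
proof (induction k)
  case 0
  then show ?case using assms(3) by (auto intro: continuous_on_inverse)
next
  case (Suc k)
  show ?case
  proof (rule Ck_on_SucI[OF assms(1)])
    show "((\<lambda>x. inverse (f x)) has_derivative
        (\<lambda>u. - (inverse (f x) * frechet_derivative f (at x) u * inverse (f x)))) (at x)"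
      if "x \<in> S" for x
      using Deriv.has_derivative_inverse[OF assms(3)[OF that] Ck_on_has_derivative[OF Suc.prems that]] .
    show "Ck_on k (\<lambda>x. - (inverse (f x) * frechet_derivative f (at x) u * inverse (f x))) S" for u
      using Suc Ck_on_SucD[OF Suc.prems] by (intro Ck_on_minus Ck_on_mult assms(1)) auto
  qed
qed

lemma Ck_on_divide:
  fixes f g :: "'a::real_normed_vector \<Rightarrow> real"
  assumes "open S" "Ck_on k f S" "Ck_on k g S" "\<And>x. x \<in> S \<Longrightarrow> g x \<noteq> 0"
  shows "Ck_on k (\<lambda>x. f x / g x) S"
  unfolding divide_inverse by (intro Ck_on_mult Ck_on_inverse assms)

lemma Ck_on_sqrt:
  fixes f :: "'a::real_normed_vector \<Rightarrow> real"
  assumes "open S" "Ck_on k f S" "\<And>x. x \<in> S \<Longrightarrow> f x > 0"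
  shows "Ck_on k (\<lambda>x. sqrt (f x)) S"
  using assms(2)
proof (induction k)
  case 0
  then show ?case by (auto intro: continuous_on_real_sqrt)
next
  case (Suc k)
  show ?case
  proof (rule Ck_on_SucI[OF assms(1)])
    show "((\<lambda>x. sqrt (f x)) has_derivative
        (\<lambda>u. frechet_derivative f (at x) u * (inverse (sqrt (f x)) / 2))) (at x)"
      if "x \<in> S" for x
      using assms(3)[OF that] Ck_on_has_derivative[OF Suc.prems that]
      by (auto intro!: derivative_eq_intros)
    have "sqrt (f x) \<noteq> 0" if "x \<in> S" for x using assms(3)[OF that] by simp
    then show "Ck_on k (\<lambda>x. frechet_derivative f (at x) u * (inverse (sqrt (f x)) / 2)) S" for u
      using Suc Ck_on_SucD[OF Suc.prems]
      by (intro Ck_on_mult Ck_on_divide Ck_on_inverse Ck_on_const assms(1)) auto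
  qed
qed

lemma Ck_on_det:
  fixes B :: "'a::real_normed_vector \<Rightarrow> real^'n^'n"
  assumes "open S" "\<And>i j. Ck_on k (\<lambda>x. B x $ i $ j) S"
  shows "Ck_on k (\<lambda>x. det (B x)) S"
  unfolding det_def by (intro Ck_on_sum Ck_on_mult Ck_on_const Ck_on_prod assms)

lemma Ck_on_vec_nth:
  "open S \<Longrightarrow> Ck_on k f S \<Longrightarrow> Ck_on k (\<lambda>x. f x $ i) S"
  by (rule Ck_on_bounded_linear[OF bounded_linear_vec_nth])

section \<open>A smooth bump on the line\<close>

text \<open>All derivatives of \<open>exp (- 1 / t)\<close> are combinations of the members of this family, which is
  closed under differentiation.\<close>

definition flat :: "nat \<Rightarrow> real \<Rightarrow> real" where
  "flat n t = (if t \<le> 0 then 0 else exp (- 1 / t) / t ^ n)"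

lemma flat_nonneg: "0 \<le> flat n t" by (simp add: flat_def)

text \<open>One bound settles both continuity and differentiability at the origin, because
  \<open>flat n t / t = flat (n + 1) t\<close> for \<open>t \<noteq> 0\<close>. It comes from keeping a single term of the
  exponential series of \<open>1 / t\<close>.\<close>

lemma flat_bound: "flat n t \<le> fact (Suc n) * \<bar>t\<bar>"
proof (cases "t \<le> 0")
  case False
  then have t: "t > 0" by simp
  have "(1 / t) ^ Suc n / fact (Suc n) \<le> exp (1 / t)"
  proof -
    have s: "summable (\<lambda>k. (1 / t) ^ k / fact k)"
      using summable_exp[of "1/t"] by (simp add: field_simps)
    have "(\<Sum>k\<in>{Suc n}. (1 / t) ^ k / fact k) \<le> (\<Sum>k. (1 / t) ^ k / fact k)"
      using s t by (intro sum_le_suminf) auto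
    then show ?thesis by (simp add: exp_def field_simps scaleR_conv_of_real)
  qed
  then have "exp (- 1 / t) \<le> fact (Suc n) * t ^ Suc n"
    using t by (simp add: exp_minus power_divide divide_simps mult.commute del: fact_Suc power_Suc)
  then show ?thesis using t by (simp add: flat_def field_simps del: fact_Suc)
qed (auto simp: flat_def mult_nonneg_nonpos)

lemma flat_tendsto_0: "(flat n \<longlongrightarrow> 0) (at 0)"
proof (rule tendsto_sandwich[of "\<lambda>_. 0" _ _ "\<lambda>t. fact (Suc n) * \<bar>t\<bar>"])
  show "((\<lambda>t::real. fact (Suc n) * \<bar>t\<bar>) \<longlongrightarrow> 0) (at 0)"
    by (rule tendsto_eq_intros refl)+ simp
qed (auto intro!: always_eventually flat_nonneg flat_bound simp del: fact_Suc)

lemma flat_has_derivative: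
  "(flat n has_real_derivative flat (n + 2) t - real n * flat (n + 1) t) (at t)"
proof -
  consider "t < 0" | "t = 0" | "t > 0" by linarith
  then show ?thesis
  proof cases
    case 1
    have "((\<lambda>_. 0) has_real_derivative 0) (at t)" by simp
    then have "(flat n has_real_derivative 0) (at t)"
      by (rule has_field_derivative_transform_within_open[of _ _ _ "{..<0}"])
        (use 1 in \<open>auto simp: flat_def\<close>)
    then show ?thesis using 1 by (simp add: flat_def)
  next
    case 2
    have "((\<lambda>h. (flat n (0 + h) - flat n 0) / h) \<longlongrightarrow> 0) (at 0)"
    proof (rule Lim_transform_eventually[OF flat_tendsto_0[of "Suc n"]])
      show "\<forall>\<^sub>F h in at 0. flat (Suc n) h = (flat n (0 + h) - flat n 0) / h"
        by (auto simp: flat_def eventually_at_filter field_simps)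
    qed
    then show ?thesis using 2 by (simp add: DERIV_def flat_def)
  next
    case 3
    have "((\<lambda>t. exp (- 1 / t) / t ^ n) has_real_derivative
        flat (n + 2) t - real n * flat (n + 1) t) (at t)"
    proof (cases n)
      case 0
      then show ?thesis using 3
        by (auto intro!: derivative_eq_intros simp: flat_def field_simps power2_eq_square)
    next
      case (Suc j)
      have e: "((\<lambda>t. exp (- 1 / t)) has_real_derivative exp (- 1 / t) / t\<^sup>2) (at t)"
        using 3 by (auto intro!: derivative_eq_intros simp: field_simps power2_eq_square)
      have p: "((\<lambda>t. t ^ Suc j) has_real_derivative (1 + real j) * t ^ j) (at t)"
        using DERIV_power_Suc[OF DERIV_ident] by simp
      show ?thesis unfolding Suc using 3
        by (intro DERIV_cong[OF DERIV_divide[OF e p]]) (auto simp: flat_def field_simps power2_eq_square)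
    qed
    then show ?thesis
      by (rule has_field_derivative_transform_within_open[of _ _ _ "{0<..}"])
        (use 3 in \<open>auto simp: flat_def\<close>)
  qed
qed

lemma Ck_on_flat: "Ck_on k (flat n) UNIV"
proof (induction k arbitrary: n)
  case 0
  show ?case
    using flat_has_derivative DERIV_isCont by (force intro: continuous_at_imp_continuous_on)
next
  case (Suc k)
  show ?case
  proof (rule Ck_on_SucI)
    show "(flat n has_derivative (\<lambda>u. (flat (n + 2) t - real n * flat (n + 1) t) * u)) (at t)" for t
      using flat_has_derivative[of n t] by (simp add: has_field_derivative_def)
    show "Ck_on k (\<lambda>t. (flat (n + 2) t - real n * flat (n + 1) t) * u) UNIV" for u
      by (intro Ck_on_mult Ck_on_diff Ck_on_const Suc) auto
  qed auto
qed

section \<open>Inner products on coordinate space\<close>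

lemma linear_axis_expansion:
  fixes L :: "real^'m \<Rightarrow> real"
  assumes "linear L"
  shows "L \<xi> = (\<Sum>i\<in>UNIV. \<xi> $ i * L (axis i 1))"
proof -
  have "L \<xi> = L (\<Sum>i\<in>UNIV. \<xi> $ i *\<^sub>R axis i 1)"
    using basis_expansion[of \<xi>] by (simp add: scalar_mult_eq_scaleR)
  also have "\<dots> = (\<Sum>i\<in>UNIV. \<xi> $ i * L (axis i 1))"
    by (simp add: linear_sum[OF assms] linear_scale[OF assms])
  finally show ?thesis .
qed

definition gram :: "(real^'m \<Rightarrow> real^'m \<Rightarrow> real) \<Rightarrow> real^'m^'m" where
  "gram B = (\<chi> i j. B (axis i 1) (axis j 1))"

lemma bilinear_eq_gram:
  fixes B :: "real^'m \<Rightarrow> real^'m \<Rightarrow> real"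
  assumes "bilinear B"
  shows "B \<xi> \<eta> = \<xi> \<bullet> (gram B *v \<eta>)"
proof -
  have e: "x = (\<Sum>i\<in>UNIV. x $ i *\<^sub>R axis i 1)" for x :: "real^'m"
    using basis_expansion[of x] by (simp add: scalar_mult_eq_scaleR)
  have "B \<xi> \<eta> = B (\<Sum>i\<in>UNIV. \<xi> $ i *\<^sub>R axis i 1) (\<Sum>j\<in>UNIV. \<eta> $ j *\<^sub>R axis j 1)"
    using e by metis
  also have "\<dots> = (\<Sum>(i,j)\<in>UNIV\<times>UNIV. B (\<xi> $ i *\<^sub>R axis i 1) (\<eta> $ j *\<^sub>R axis j 1))"
    using bilinear_sum[OF assms] .
  also have "\<dots> = (\<Sum>i\<in>UNIV. \<Sum>j\<in>UNIV. \<xi> $ i * \<eta> $ j * B (axis i 1) (axis j 1))"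
    by (simp add: bilinear_lmul[OF assms] bilinear_rmul[OF assms] sum.cartesian_product mult_ac)
  also have "\<dots> = \<xi> \<bullet> (gram B *v \<eta>)"
    by (simp add: inner_vec_def matrix_vector_mult_def gram_def sum_distrib_left mult_ac)
  finally show ?thesis .
qed

lemma gram_compose_linear:
  fixes B :: "real^'m \<Rightarrow> real^'m \<Rightarrow> real"
  assumes "bilinear B" "linear L"
  shows "gram (\<lambda>\<xi> \<eta>. B (L \<xi>) (L \<eta>)) = transpose (matrix L) ** gram B ** matrix L"
proof -
  let ?J = "matrix L"
  have "B (L (axis i 1)) (L (axis j 1)) = (transpose ?J ** gram B ** ?J) $ i $ j" for i j
  proof -
    have adj: "(?J *v x) \<bullet> z = x \<bullet> (transpose ?J *v z)" for x z
      by (metis dot_lmul_matrix vector_transpose_matrix)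
    have "B (L (axis i 1)) (L (axis j 1)) = (?J *v axis i 1) \<bullet> (gram B *v (?J *v axis j 1))"
      using bilinear_eq_gram[OF assms(1)] fun_cong[OF matrix_vector_mul(2)[OF assms(2)]] by simp
    also have "\<dots> = axis i 1 \<bullet> ((transpose ?J ** gram B ** ?J) *v axis j 1)"
      by (simp only: adj matrix_vector_mul_assoc matrix_mul_assoc)
    also have "\<dots> = (transpose ?J ** gram B ** ?J) $ i $ j"
      by (simp add: inner_axis' matrix_vector_mult_basis column_def)
    finally show ?thesis .
  qed
  then show ?thesis by (simp add: gram_def vec_eq_iff)
qed

lemma is_inner_productD:
  assumes "is_inner_product B"
  shows "bilinear B" "B x y = B y x" "x \<noteq> 0 \<Longrightarrow> B x x > 0"
  using assms by (auto simp: is_inner_product_def)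

text \<open>The segment from the identity to the Gram matrix stays inside the inner products, so the
  determinant cannot change sign along it.\<close>

lemma det_gram_pos:
  fixes B :: "real^'m \<Rightarrow> real^'m \<Rightarrow> real"
  assumes B: "is_inner_product B"
  shows "det (gram B) > 0"
proof (rule ccontr)
  let ?M = "\<lambda>t::real. (\<chi> i j. (1 - t) * mat 1 $ i $ j + t * gram B $ i $ j) :: real^'m^'m"
  let ?d = "\<lambda>t. det (?M t)"
  assume "\<not> det (gram B) > 0"
  moreover have "?M 0 = mat 1" "?M 1 = gram B" by (simp_all add: vec_eq_iff)
  ultimately have "?d 1 \<le> 0" "0 \<le> ?d 0" by simp_all
  moreover have "continuous_on {0..1} ?d"
    unfolding det_def by (auto intro!: continuous_intros)
  ultimately obtain t where t: "0 \<le> t" "t \<le> 1" "?d t = 0"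
    using IVT2'[of ?d 1 0 0] by auto
  then have "\<not> invertible (?M t)" by (simp add: invertible_det_nz)
  then obtain x where x: "?M t *v x = 0" "x \<noteq> 0"
    unfolding invertible_left_inverse matrix_left_invertible_ker by blast
  have "?M t *v x = (1 - t) *\<^sub>R x + t *\<^sub>R (gram B *v x)"
  proof -
    have "(?M t *v x) $ i = (1 - t) * (mat 1 *v x) $ i + t * (gram B *v x) $ i" for i
      by (simp add: matrix_vector_mult_def sum_distrib_left algebra_simps flip: sum.distrib)
    then show ?thesis by (simp add: vec_eq_iff)
  qed
  then have "0 = x \<bullet> ((1 - t) *\<^sub>R x + t *\<^sub>R (gram B *v x))" using x(1) by simp
  also have "\<dots> = (1 - t) * (x \<bullet> x) + t * B x x"
    by (simp add: inner_add_right bilinear_eq_gram[OF is_inner_productD(1)[OF B]])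
  finally have "(1 - t) * (x \<bullet> x) + t * B x x = 0" by simp
  moreover have "x \<bullet> x > 0" "B x x > 0" using x is_inner_productD(3)[OF B] by auto
  moreover from this t have "0 \<le> (1 - t) * (x \<bullet> x)" by simp
  moreover have "t = 0 \<or> 0 < t * B x x"
    using t(1) \<open>B x x > 0\<close> by (metis less_eq_real_def mult_pos_pos)
  ultimately show False by auto
qed

text \<open>Cramer's rule, because it displays the solution as a smooth function of the data.\<close>

definition cramer_solve :: "real^'m^'m \<Rightarrow> real^'m \<Rightarrow> real^'m" where
  "cramer_solve M b = (\<chi> k. det (\<chi> i j. if j = k then b $ i else M $ i $ j) / det M)"

lemma cramer_solve: "det M \<noteq> 0 \<Longrightarrow> M *v cramer_solve M b = b"
  using cramer[of M "cramer_solve M b" b] by (simp add: cramer_solve_def)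

text \<open>The Riesz representative of a linear form, written through Cramer's rule.\<close>

lemma gram_solve_eq:
  assumes B: "is_inner_product B" and L: "linear L"
  shows "B (cramer_solve (gram B) (\<chi> i. L (axis i 1))) \<eta> = L \<eta>"
proof -
  let ?b = "\<chi> i. L (axis i 1)"
  have "B (cramer_solve (gram B) ?b) \<eta> = \<eta> \<bullet> (gram B *v cramer_solve (gram B) ?b)"
    using is_inner_productD(2)[OF B] bilinear_eq_gram[OF is_inner_productD(1)[OF B]] by metis
  also have "\<dots> = \<eta> \<bullet> ?b" using det_gram_pos[OF B] by (simp add: cramer_solve)
  also have "\<dots> = L \<eta>" using linear_axis_expansion[OF L, of \<eta>] by (simp add: inner_vec_def)
  finally show ?thesis .
qed

text \<open>The matrix determinant lemma. After a rotation taking \<open>b\<close> to a multiple of a coordinate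
  vector only one column differs from the identity, and Cramer's rule reads off the determinant.\<close>

lemma det_mat1_plus_rank1:
  fixes a b :: "real^'m"
  shows "det (\<chi> i j. mat 1 $ i $ j + a $ i * b $ j) = 1 + a \<bullet> b"
proof (cases "b = 0")
  case True
  have "(\<chi> i j. mat 1 $ i $ j + a $ i * b $ j) = (mat 1 :: real^'m^'m)" using True by (simp add: vec_eq_iff)
  then show ?thesis using True by simp
next
  case False
  obtain k :: 'm where True by blast
  obtain f where f: "orthogonal_transformation f" "f (b /\<^sub>R norm b) = axis k (1::real)"
    using orthogonal_transformation_exists_1[of "b /\<^sub>R norm b" "axis k 1"] False by auto
  define Q where "Q = matrix f"
  have lf: "linear f" using f(1) by (simp add: orthogonal_transformation_def)
  have fQ: "f x = Q *v x" for x using fun_cong[OF matrix_vector_mul(2)[OF lf]] by (simp add: Q_def)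
  have oQ: "orthogonal_matrix Q"
    using f(1) by (simp add: orthogonal_transformation_matrix Q_def)
  let ?P = "\<lambda>a b. (\<chi> i j. mat 1 $ i $ j + a $ i * b $ j) :: real^'m^'m"
  have Pv: "?P a b *v x = x + (b \<bullet> x) *\<^sub>R a" for a b x :: "real^'m"
  proof -
    have "(?P a b *v x) $ i = (mat 1 *v x) $ i + (b \<bullet> x) * a $ i" for i
      by (simp add: matrix_vector_mult_def sum.distrib sum_distrib_left inner_vec_def algebra_simps)
    then show ?thesis by (simp add: vec_eq_iff)
  qed
  have fb: "f b = norm b *\<^sub>R axis k 1"
    using f(2) False by (simp add: linear_scale[OF lf] field_simps vec_eq_iff)
  have "Q ** ?P a b = ?P (f a) (f b) ** Q"
  proof (rule matrix_eq[THEN iffD2], rule allI)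
    fix x
    have "f b \<bullet> f x = b \<bullet> x" using f(1) by (simp add: orthogonal_transformation_def)
    then show "(Q ** ?P a b) *v x = (?P (f a) (f b) ** Q) *v x"
      by (simp only: matrix_vector_mul_assoc[symmetric] Pv fQ[symmetric] linear_add[OF lf] linear_scale[OF lf])
  qed
  then have "det (Q ** ?P a b) = det (?P (f a) (f b) ** Q)" by (rule arg_cong)
  then have "det Q * det (?P a b) = det (?P (f a) (f b)) * det Q" by (simp only: det_mul)
  moreover have "det Q \<noteq> 0" using det_orthogonal_matrix[OF oQ] by auto
  ultimately have "det (?P a b) = det (?P (f a) (f b))" by simp
  also have "\<dots> = 1 + norm b * f a $ k"
  proof -
    let ?x = "axis k 1 + norm b *\<^sub>R f a"
    have "?P (f a) (f b) = (\<chi> i j. if j = k then (mat 1 *v ?x) $ i else mat 1 $ i $ j)"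
      unfolding matrix_vector_mul_lid by (simp add: vec_eq_iff fb mat_def axis_def)
    then have "det (?P (f a) (f b)) = ?x $ k * det (mat 1 :: real^'m^'m)"
      by (simp only: cramer_lemma)
    then show ?thesis by (simp add: axis_def)
  qed
  also have "norm b * f a $ k = f a \<bullet> f b" by (simp add: fb inner_axis)
  also have "\<dots> = a \<bullet> b" using f(1) by (simp add: orthogonal_transformation_def)
  finally show ?thesis .
qed

section \<open>Tangent vectors in coordinates\<close>

text \<open>The tangent vector with coordinates \<open>\<xi>\<close> in the chart \<open>c\<close>. Every computation on tangent
  spaces is transported to coordinate space along this linear isomorphism.\<close>

definition tangent_of ::
    "('a, 'm::finite) chart set \<Rightarrow> ('a, 'm) chart \<Rightarrow> 'a \<Rightarrow> real^'m \<Rightarrow> ('a, 'm) tvec" where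
  "tangent_of A c p \<xi> = (\<lambda>c'. if c' \<in> A \<and> p \<in> fst c' then transition_deriv c c' p \<xi> else 0)"

lemma coord_vec_eq: "coord_vec A c p i = tangent_of A c p (axis i 1)"
  by (simp add: coord_vec_def tangent_of_def)

lemma metric_matrix_eq_gram:
  "metric_matrix A h c p = gram (\<lambda>\<xi> \<eta>. h p (tangent_of A c p \<xi>) (tangent_of A c p \<eta>))"
  by (simp add: metric_matrix_def gram_def coord_vec_eq)

locale compact_manifold =
  fixes A :: "('a::{t2_space,second_countable_topology}, 'm::{finite,wellorder}) chart set"
  assumes atlas: "smooth_atlas A" and compact_UNIV: "compact (UNIV :: 'a set)"
begin

abbreviation chart_image :: "('a, 'm) chart \<Rightarrow> (real, 'm) vec set" where
  "chart_image c \<equiv> snd c ` fst c"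

abbreviation tv :: "('a, 'm) chart \<Rightarrow> 'a \<Rightarrow> (real, 'm) vec \<Rightarrow> ('a, 'm) tvec" where
  "tv \<equiv> tangent_of A"

lemma
  assumes "c \<in> A"
  shows open_chart: "open (fst c)" and open_chart_image: "open (chart_image c)"
    and chart_homeomorphism: "homeomorphism (fst c) (chart_image c) (snd c) (chart_inv c)"
  using assms atlas by (auto simp: smooth_atlas_def)

lemma
  assumes "c \<in> A"
  shows continuous_on_chart: "continuous_on (fst c) (snd c)"
    and continuous_on_chart_inv: "continuous_on (chart_image c) (chart_inv c)"
    and chart_inv_chart: "p \<in> fst c \<Longrightarrow> chart_inv c (snd c p) = p"
    and chart_chart_inv: "x \<in> chart_image c \<Longrightarrow> snd c (chart_inv c x) = x"
    and chart_inv_in: "x \<in> chart_image c \<Longrightarrow> chart_inv c x \<in> fst c"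
  using chart_homeomorphism[OF assms] by (auto simp: homeomorphism_def)

lemma chart_at: obtains c where "c \<in> A" "p \<in> fst c"
proof -
  have "p \<in> (\<Union>c\<in>A. fst c)" using atlas unfolding smooth_atlas_def by blast
  then show ?thesis using that by blast
qed

lemma open_chart_image_of:
  assumes "c \<in> A" "open W"
  shows "open (snd c ` (fst c \<inter> W))"
proof -
  have "snd c ` (fst c \<inter> W) = chart_image c \<inter> chart_inv c -` W"
    using chart_inv_chart[OF assms(1)] by (auto simp: image_iff) 
  then show ?thesis
    using continuous_open_preimage[OF continuous_on_chart_inv open_chart_image assms(2)] assms(1) by simp
qed

lemma open_overlap: "c \<in> A \<Longrightarrow> c' \<in> A \<Longrightarrow> open (snd c ` (fst c \<inter> fst c'))"
  by (rule open_chart_image_of[OF _ open_chart])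

lemma Ck_on_transition:
  "c \<in> A \<Longrightarrow> c' \<in> A \<Longrightarrow> Ck_on k (snd c' \<circ> chart_inv c) (snd c ` (fst c \<inter> fst c'))"
  using atlas by (auto simp: smooth_atlas_def)

lemma transition_has_derivative:
  assumes "c \<in> A" "c' \<in> A" "p \<in> fst c" "p \<in> fst c'"
  shows "((snd c' \<circ> chart_inv c) has_derivative transition_deriv c c' p) (at (snd c p))"
  unfolding transition_deriv_def
  using Ck_on_has_derivative[OF Ck_on_transition[OF assms(1,2), of "Suc 0"]] assms by auto

lemma linear_transition_deriv:
  assumes "c \<in> A" "c' \<in> A" "p \<in> fst c" "p \<in> fst c'"
  shows "linear (transition_deriv c c' p)"
  using has_derivative_linear[OF transition_has_derivative[OF assms]] .

text \<open>The chain rule for an arbitrary function of the manifold under a change of chart; transition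
  maps themselves are the special case where the function is a chart.\<close>

lemma chart_change_has_derivative:
  assumes "c \<in> A" "c' \<in> A" "p \<in> fst c" "p \<in> fst c'"
    and "((f \<circ> chart_inv c') has_derivative D) (at (snd c' p))"
  shows "((f \<circ> chart_inv c) has_derivative (\<lambda>\<xi>. D (transition_deriv c c' p \<xi>))) (at (snd c p))"
proof -
  have "(snd c' \<circ> chart_inv c) (snd c p) = snd c' p" using chart_inv_chart assms by simp
  then have "(((f \<circ> chart_inv c') \<circ> (snd c' \<circ> chart_inv c)) has_derivative
      (\<lambda>\<xi>. D (transition_deriv c c' p \<xi>))) (at (snd c p))"
    using diff_chain_at[OF transition_has_derivative[OF assms(1-4)], of "f \<circ> chart_inv c'" D] assms(5)
    by (simp add: o_def)
  then show ?thesis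
  proof (rule has_derivative_transform_within_open[OF _ open_overlap[OF assms(1,2)]])
    show "snd c p \<in> snd c ` (fst c \<inter> fst c')" using assms by auto
    show "((f \<circ> chart_inv c') \<circ> (snd c' \<circ> chart_inv c)) x = (f \<circ> chart_inv c) x"
      if x: "x \<in> snd c ` (fst c \<inter> fst c')" for x
    proof -
      obtain q where q: "q \<in> fst c" "q \<in> fst c'" "x = snd c q" using x by blast
      then show ?thesis by (simp add: chart_inv_chart[OF assms(1)] chart_inv_chart[OF assms(2)])
    qed
  qed
qed

lemma transition_deriv_cocycle:
  assumes "c \<in> A" "c' \<in> A" "c'' \<in> A" "p \<in> fst c" "p \<in> fst c'" "p \<in> fst c''"
  shows "transition_deriv c' c'' p (transition_deriv c c' p \<xi>) = transition_deriv c c'' p \<xi>"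
  using fun_cong[OF has_derivative_unique[OF transition_has_derivative[of c c'' p]
      chart_change_has_derivative[OF assms(1,2,4,5) transition_has_derivative[of c' c'' p]]]] assms
  by simp

lemma transition_deriv_id:
  assumes "c \<in> A" "p \<in> fst c"
  shows "transition_deriv c c p \<xi> = \<xi>"
proof -
  have "((\<lambda>x. x) has_derivative transition_deriv c c p) (at (snd c p))"
    by (rule has_derivative_transform_within_open[OF transition_has_derivative open_chart_image[of c]])
      (use assms in \<open>auto simp: chart_inv_chart[OF assms(1)]\<close>)
  then have "transition_deriv c c p = (\<lambda>x. x)" using has_derivative_unique[OF _ has_derivative_ident] by blast
  then show ?thesis by simp
qed

lemma tv_nth: "c \<in> A \<Longrightarrow> p \<in> fst c \<Longrightarrow> tv c p \<xi> c = \<xi>"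
  by (simp add: tangent_of_def transition_deriv_id)

lemma tv_in_tangent_space: "c \<in> A \<Longrightarrow> p \<in> fst c \<Longrightarrow> tv c p \<xi> \<in> tangent_space A p"
  by (auto simp: tangent_space_def tangent_of_def transition_deriv_cocycle)

lemma tangent_space_eq_tv:
  assumes "c \<in> A" "p \<in> fst c" "u \<in> tangent_space A p"
  shows "u = tv c p (u c)"
proof
  fix c' show "u c' = tv c p (u c) c'"
  proof (cases "c' \<in> A \<and> p \<in> fst c'")
    case True
    then have "u c' = transition_deriv c c' p (u c)" using assms unfolding tangent_space_def by blast
    then show ?thesis using True by (simp only: tangent_of_def simp_thms if_True)
  next
    case False
    then have "u c' = 0" using assms unfolding tangent_space_def by blast
    then show ?thesis using False by (simp only: tangent_of_def simp_thms if_False)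
  qed
qed

lemma tangent_space_iff:
  "c \<in> A \<Longrightarrow> p \<in> fst c \<Longrightarrow> u \<in> tangent_space A p \<longleftrightarrow> (\<exists>\<xi>. u = tv c p \<xi>)"
  using tangent_space_eq_tv tv_in_tangent_space by blast

lemma tv_change_chart:
  assumes "c \<in> A" "c' \<in> A" "p \<in> fst c" "p \<in> fst c'"
  shows "tv c p \<xi> = tv c' p (transition_deriv c c' p \<xi>)"
  using assms by (auto simp: tangent_of_def transition_deriv_cocycle)

text \<open>The differential may be computed in any chart around the point, not only in the one selected by
  its definition.\<close>

lemma differential_tv:
  assumes "Ck_map A (Suc k) f" "c \<in> A" "p \<in> fst c"
  shows "differential A f p (tv c p \<xi>) = frechet_derivative (f \<circ> chart_inv c) (at (snd c p)) \<xi>"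
proof -
  define c' where "c' = (SOME c. c \<in> A \<and> p \<in> fst c)"
  have c': "c' \<in> A" "p \<in> fst c'" using someI[of "\<lambda>c. c \<in> A \<and> p \<in> fst c" c] assms by (auto simp: c'_def)
  have D: "((f \<circ> chart_inv c) has_derivative frechet_derivative (f \<circ> chart_inv c) (at (snd c p))) (at (snd c p))"
    if "c \<in> A" "p \<in> fst c" for c
    using assms(1) that by (intro Ck_on_has_derivative[of k _ "chart_image c"]) (auto simp: Ck_map_def simp del: Ck_on.simps)
  have "tv c p \<xi> c' = transition_deriv c c' p \<xi>" using c' by (simp add: tangent_of_def)
  moreover have "frechet_derivative (f \<circ> chart_inv c) (at (snd c p)) =
      (\<lambda>\<xi>. frechet_derivative (f \<circ> chart_inv c') (at (snd c' p)) (transition_deriv c c' p \<xi>))"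
    using has_derivative_unique[OF D chart_change_has_derivative[OF _ _ _ _ D]] assms c' by blast
  ultimately show ?thesis
    by (simp add: differential_def c'_def[symmetric])
qed

lemma differential_tv_has_derivative:
  assumes "Ck_map A (Suc k) f" "c \<in> A" "p \<in> fst c"
  shows "((f \<circ> chart_inv c) has_derivative (\<lambda>\<xi>. differential A f p (tv c p \<xi>))) (at (snd c p))"
  unfolding differential_tv[OF assms]
  using assms by (intro Ck_on_has_derivative[of k _ "chart_image c"]) (auto simp: Ck_map_def simp del: Ck_on.simps)

lemma linear_differential_tv:
  assumes "Ck_map A (Suc k) f" "c \<in> A" "p \<in> fst c"
  shows "linear (\<lambda>\<xi>. differential A f p (tv c p \<xi>))"
  using has_derivative_linear[OF differential_tv_has_derivative[OF assms]] .

lemma Ck_map_le: "Ck_map A k f \<Longrightarrow> j \<le> k \<Longrightarrow> Ck_map A j f"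
  by (auto simp: Ck_map_def intro: Ck_on_le)

text \<open>This turns continuity statements on the manifold into statements about coordinate expressions.\<close>

lemma Ck_map_0_iff_continuous: "Ck_map A 0 f \<longleftrightarrow> continuous_on UNIV f"
proof
  assume f: "Ck_map A 0 f"
  have "isCont f p" for p
  proof -
    obtain c where c: "c \<in> A" "p \<in> fst c" using chart_at .
    have "continuous_on (fst c) (\<lambda>q. (f \<circ> chart_inv c) (snd c q))"
      using f c by (intro continuous_on_compose2[OF _ continuous_on_chart]) (auto simp: Ck_map_def)
    then have "continuous_on (fst c) f"
      by (rule continuous_on_eq) (use c chart_inv_chart in auto)
    then show "isCont f p" using open_chart c continuous_on_eq_continuous_at by blast
  qed
  then show "continuous_on UNIV f" by (simp add: continuous_at_imp_continuous_on)
next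
  assume f: "continuous_on UNIV f"
  then show "Ck_map A 0 f"
    by (auto simp: Ck_map_def o_def intro: continuous_on_compose2[OF f continuous_on_chart_inv])
qed

lemma Ck_map_imp_continuous: "Ck_map A k f \<Longrightarrow> continuous_on UNIV f"
  using Ck_map_le[of k f 0] Ck_map_0_iff_continuous by auto

lemma continuous_on_UNIV_charts:
  assumes "\<And>c. c \<in> A \<Longrightarrow> Ck_on k (\<lambda>x. f (chart_inv c x)) (chart_image c)"
  shows "continuous_on UNIV f"
  by (rule Ck_map_imp_continuous[of k]) (use assms in \<open>auto simp: Ck_map_def o_def\<close>)


lemma Ck_on_differential:
  assumes "Ck_map A (Suc k) f" "c \<in> A"
  shows "Ck_on k (\<lambda>x. differential A f (chart_inv c x) (tv c (chart_inv c x) \<xi>)) (chart_image c)"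
proof -
  have "Ck_on k (\<lambda>x. frechet_derivative (f \<circ> chart_inv c) (at x) \<xi>) (chart_image c)"
    using assms by (simp add: Ck_map_def)
  then show ?thesis
    by (rule Ck_on_cong[OF open_chart_image[OF assms(2)], rotated])
      (use assms in \<open>auto simp: differential_tv chart_inv_chart\<close>)
qed

end

section \<open>The Riemannian volume measure\<close>

text \<open>The change of variables formula for nonnegative functions holds in the extended sense: it
  determines which finite values occur on either side, so one side is infinite exactly when the other
  is.\<close>

lemma nn_integral_change_of_variables:
  fixes g h :: "real^'m::{finite,wellorder} \<Rightarrow> real^'m::_" and f :: "real^'m::_ \<Rightarrow> real"
  assumes S: "S \<in> sets borel" and T: "T \<in> sets borel"
    and Df: "(\<lambda>x. indicator T x * f x) \<in> borel_measurable borel"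
    and Dg: "(\<lambda>x. indicator S x * (\<bar>det (matrix (g' x))\<bar> * f (g x))) \<in> borel_measurable borel"
    and der_g: "\<And>x. x \<in> S \<Longrightarrow> (g has_derivative g' x) (at x)"
    and der_h: "\<And>y. y \<in> T \<Longrightarrow> (h has_derivative h' y) (at y)"
    and f0: "\<And>y. y \<in> T \<Longrightarrow> 0 \<le> f y"
    and hg: "\<And>x. x \<in> S \<Longrightarrow> g x \<in> T \<and> h (g x) = x"
    and gh: "\<And>y. y \<in> T \<Longrightarrow> h y \<in> S \<and> g (h y) = y"
    and id: "\<And>y. y \<in> T \<Longrightarrow> h' y \<circ> g' (h y) = id"
  shows "(\<integral>\<^sup>+y\<in>T. ennreal (f y) \<partial>lborel) = (\<integral>\<^sup>+x\<in>S. ennreal (\<bar>det (matrix (g' x))\<bar> * f (g x)) \<partial>lborel)"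
proof -
  let ?F = "\<lambda>x. \<bar>det (matrix (g' x))\<bar> * f (g x)"
  have cov: "(?F has_integral b) S \<longleftrightarrow> (f has_integral b) T" for b
  proof (rule cov_invertible_nonneg_eq[where h=h and h'=h'])
    show "(g has_derivative g' x) (at x within S)" if "x \<in> S" for x
      by (rule has_derivative_at_withinI[OF der_g[OF that]])
    show "(h has_derivative h' y) (at y within T)" if "y \<in> T" for y
      by (rule has_derivative_at_withinI[OF der_h[OF that]])
  qed (fact f0 hg gh id)+
  have F0: "0 \<le> ?F x" if "x \<in> S" for x using hg[OF that] f0 by simp
  have char: "(\<integral>\<^sup>+x\<in>R. ennreal (k x) \<partial>lborel) = ennreal b \<longleftrightarrow> (k has_integral b) R"
    if "R \<in> sets borel" "(\<lambda>x. indicator R x * k x) \<in> borel_measurable borel"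
      "\<And>x. x \<in> R \<Longrightarrow> 0 \<le> k x" "0 \<le> b" for R b and k :: "real^'m::_ \<Rightarrow> real"
  proof
    assume "(\<integral>\<^sup>+x\<in>R. ennreal (k x) \<partial>lborel) = ennreal b"
    then have "(\<integral>\<^sup>+x. ennreal (indicator R x * k x) \<partial>lborel) = ennreal b"
      by (simp add: nn_integral_set_ennreal mult.commute)
    then have "((\<lambda>x. indicator R x * k x) has_integral b) UNIV"
      using that by (intro nn_integral_has_integral) (auto simp: indicator_def)
    then have "((\<lambda>x. if x \<in> R then k x else 0) has_integral b) UNIV"
      by (rule has_integral_eq[rotated]) (auto simp: indicator_def)
    then show "(k has_integral b) R" by (simp add: has_integral_restrict_UNIV)
  next
    assume "(k has_integral b) R"
    then show "(\<integral>\<^sup>+x\<in>R. ennreal (k x) \<partial>lborel) = ennreal b"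
      using nn_integral_has_integral_lebesgue'[of R k b] that by simp
  qed

  have cf: "(\<integral>\<^sup>+y\<in>T. ennreal (f y) \<partial>lborel) = ennreal b \<longleftrightarrow> (f has_integral b) T" if "0 \<le> b" for b
    by (rule char[OF T Df _ that]) (rule f0)
  have cF: "(\<integral>\<^sup>+x\<in>S. ennreal (?F x) \<partial>lborel) = ennreal b \<longleftrightarrow> (?F has_integral b) S" if "0 \<le> b" for b
    by (rule char[OF S Dg _ that]) (rule F0)
  show ?thesis
  proof (cases "\<integral>\<^sup>+y\<in>T. ennreal (f y) \<partial>lborel")
    case (real b)
    have "(f has_integral b) T" using cf[OF real(1)] real(2) by blast
    then have "(?F has_integral b) S" using cov by blast
    then have "(\<integral>\<^sup>+x\<in>S. ennreal (?F x) \<partial>lborel) = ennreal b" using cF[OF real(1)] by blast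
    then show ?thesis using real(2) by (rule trans[OF _ sym, rotated])
  next
    case top
    show ?thesis
    proof (cases "\<integral>\<^sup>+x\<in>S. ennreal (?F x) \<partial>lborel")
      case (real b)
      have "(?F has_integral b) S" using cF[OF real(1)] real(2) by blast
      then have "(f has_integral b) T" using cov by blast
      then have "(\<integral>\<^sup>+y\<in>T. ennreal (f y) \<partial>lborel) = ennreal b" using cf[OF real(1)] by blast
      then show ?thesis using real(2) by (rule trans[OF _ sym])
    next
      case top' : top
      then show ?thesis using top by simp
    qed
  qed
qed

context compact_manifold
begin

text \<open>Regularity \<open>C\<^sup>1\<close> is what an embedding of class \<open>C\<^sup>2\<close> induces, and it suffices for a
  continuous divergence.\<close>

definition C1_metric :: "('a, 'm) metric \<Rightarrow> bool" where
  "C1_metric h \<longleftrightarrow>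
     (\<forall>c\<in>A. \<forall>p\<in>fst c. is_inner_product (\<lambda>\<xi> \<eta>. h p (tv c p \<xi>) (tv c p \<eta>))) \<and>
     (\<forall>c\<in>A. \<forall>i j. Ck_on 1 (\<lambda>x. metric_matrix A h c (chart_inv c x) $ i $ j) (chart_image c))"

definition vol_density :: "('a, 'm) metric \<Rightarrow> ('a, 'm) chart \<Rightarrow> (real, 'm) vec \<Rightarrow> real" where
  "vol_density h c x = sqrt (det (metric_matrix A h c (chart_inv c x)))"

text \<open>The density vanishes outside the chart image, so the value \<open>undefined\<close> is attained on a null
  set only.\<close>

definition chart_volume :: "('a, 'm) metric \<Rightarrow> ('a, 'm) chart \<Rightarrow> 'a measure" where
  "chart_volume h c =
     distr (density lborel (\<lambda>x. ennreal (indicator (chart_image c) x * vol_density h c x))) borel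
       (\<lambda>x. if x \<in> chart_image c then chart_inv c x else undefined)"

lemma C1_metricD:
  assumes "C1_metric h" "c \<in> A"
  shows "p \<in> fst c \<Longrightarrow> is_inner_product (\<lambda>\<xi> \<eta>. h p (tv c p \<xi>) (tv c p \<eta>))"
    and "Ck_on 1 (\<lambda>x. metric_matrix A h c (chart_inv c x) $ i $ j) (chart_image c)"
  using assms unfolding C1_metric_def by blast+

lemma det_metric_matrix_pos:
  assumes "C1_metric h" "c \<in> A" "p \<in> fst c"
  shows "det (metric_matrix A h c p) > 0"
  unfolding metric_matrix_eq_gram using det_gram_pos C1_metricD(1)[OF assms] by blast

lemma vol_density_pos:
  "C1_metric h \<Longrightarrow> c \<in> A \<Longrightarrow> x \<in> chart_image c \<Longrightarrow> vol_density h c x > 0"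
  unfolding vol_density_def using det_metric_matrix_pos chart_inv_in by simp

lemma vol_density_nonneg:
  assumes "C1_metric h" "c \<in> A"
  shows "indicator (chart_image c) x * vol_density h c x \<ge> 0"
  using vol_density_pos[OF assms, of x] by (cases "x \<in> chart_image c") (simp_all add: less_imp_le)

lemma Ck_on_vol_density:
  assumes "C1_metric h" "c \<in> A"
  shows "Ck_on 1 (vol_density h c) (chart_image c)"
  unfolding vol_density_def using assms
  by (intro Ck_on_sqrt Ck_on_det open_chart_image C1_metricD(2)) (auto intro: det_metric_matrix_pos chart_inv_in)

lemma borel_chart [measurable]: "c \<in> A \<Longrightarrow> fst c \<in> sets borel"
  and borel_chart_image [measurable]: "c \<in> A \<Longrightarrow> chart_image c \<in> sets borel"
  using open_chart open_chart_image by auto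

lemma measurable_vol_density:
  assumes "C1_metric h" "c \<in> A"
  shows "(\<lambda>x. indicator (chart_image c) x * vol_density h c x) \<in> borel_measurable borel"
  using borel_measurable_continuous_on_indicator[OF borel_chart_image
      Ck_on_imp_continuous[OF Ck_on_vol_density[OF assms]]] assms by simp

lemma measurable_chart_inv:
  assumes "c \<in> A"
  shows "(\<lambda>x. if x \<in> chart_image c then chart_inv c x else q) \<in> borel_measurable borel"
  using assms by (intro borel_measurable_continuous_on_if continuous_on_chart_inv) auto

lemma chart_image_Int_eq:
  assumes "c \<in> A"
  shows "snd c ` (fst c \<inter> B) = chart_image c \<inter> (\<lambda>x. if x \<in> chart_image c then chart_inv c x else q) -` B"
  using chart_inv_chart[OF assms] by auto

lemma borel_chart_image_of:
  assumes "c \<in> A" "B \<in> sets borel"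
  shows "snd c ` (fst c \<inter> B) \<in> sets borel"
proof -
  have "(\<lambda>x. if x \<in> chart_image c then chart_inv c x else undefined) -` B \<in> sets borel"
    using measurable_sets[OF measurable_chart_inv assms(2)] assms(1) by auto
  then show ?thesis
    unfolding chart_image_Int_eq[OF assms(1), of B undefined] using borel_chart_image[OF assms(1)] by auto
qed

lemma sets_chart_volume [measurable_cong, simp]: "sets (chart_volume h c) = sets borel"
  by (simp add: chart_volume_def)

lemma emeasure_chart_volume:
  assumes "C1_metric h" "c \<in> A" "B \<in> sets borel"
  shows "emeasure (chart_volume h c) B =
    (\<integral>\<^sup>+x\<in>snd c ` (fst c \<inter> B). ennreal (vol_density h c x) \<partial>lborel)"
proof -
  let ?e = "\<lambda>x. if x \<in> chart_image c then chart_inv c x else undefined"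
  let ?w = "\<lambda>x. indicator (chart_image c) x * vol_density h c x"
  have "?e -` B \<in> sets borel"
    using measurable_sets[OF measurable_chart_inv assms(3)] assms(2) by auto
  then have "emeasure (chart_volume h c) B = (\<integral>\<^sup>+x. ennreal (?w x) * indicator (?e -` B) x \<partial>lborel)"
    unfolding chart_volume_def using assms(3) measurable_chart_inv[OF assms(2)]
      measurable_vol_density[OF assms(1,2)]
    by (subst emeasure_distr) (auto simp: emeasure_density)
  also have "\<dots> = (\<integral>\<^sup>+x\<in>snd c ` (fst c \<inter> B). ennreal (vol_density h c x) \<partial>lborel)"
    unfolding chart_image_Int_eq[OF assms(2), of B undefined]
    by (intro nn_integral_cong) (auto simp: indicator_def)
  finally show ?thesis .
qed

lemma emeasure_chart_volume_subset:
  assumes "C1_metric h" "c \<in> A" "B \<in> sets borel" "B \<subseteq> fst c"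
  shows "emeasure (chart_volume h c) B = (\<integral>\<^sup>+x\<in>snd c ` B. ennreal (vol_density h c x) \<partial>lborel)"
proof -
  have "fst c \<inter> B = B" using assms by auto
  then show ?thesis using emeasure_chart_volume[OF assms(1-3)] by simp
qed

lemma det_metric_matrix_change_chart:
  assumes "C1_metric h" "c \<in> A" "c' \<in> A" "p \<in> fst c" "p \<in> fst c'"
  shows "det (metric_matrix A h c p) =
    (det (matrix (transition_deriv c c' p)))\<^sup>2 * det (metric_matrix A h c' p)"
proof -
  have "metric_matrix A h c p = gram (\<lambda>\<xi> \<eta>. h p (tv c' p (transition_deriv c c' p \<xi>))
      (tv c' p (transition_deriv c c' p \<eta>)))"
    unfolding metric_matrix_eq_gram using tv_change_chart[OF assms(2-5)] by simp
  also have "\<dots> = transpose (matrix (transition_deriv c c' p)) ** metric_matrix A h c' p **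
      matrix (transition_deriv c c' p)"
    unfolding metric_matrix_eq_gram
    using gram_compose_linear[OF is_inner_productD(1)[OF C1_metricD(1)[OF assms(1,3,5)]]
        linear_transition_deriv[OF assms(2-5)]] .
  finally show ?thesis by (simp add: det_mul det_transpose power2_eq_square)
qed

text \<open>Under a change of chart with Jacobian \<open>J\<close> the Gram matrix becomes \<open>J\<^sup>T G J\<close>, so the
  density is multiplied by \<open>\<bar>det J\<bar>\<close>, which is the factor in the change of variables formula.\<close>

lemma chart_volume_agree:
  assumes h: "C1_metric h" and c: "c \<in> A" "c' \<in> A"
    and B: "B \<in> sets borel" "B \<subseteq> fst c" "B \<subseteq> fst c'"
  shows "emeasure (chart_volume h c) B = emeasure (chart_volume h c') B"
proof -
  let ?S = "snd c ` B" and ?T = "snd c' ` B"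
  let ?g = "snd c' \<circ> chart_inv c" and ?h = "snd c \<circ> chart_inv c'"
  let ?g' = "\<lambda>x. transition_deriv c c' (chart_inv c x)"
  let ?h' = "\<lambda>y. transition_deriv c' c (chart_inv c' y)"
  have dens: "vol_density h c x = \<bar>det (matrix (?g' x))\<bar> * vol_density h c' (?g x)" if x: "x \<in> ?S" for x
  proof -
    obtain p where p: "p \<in> B" "x = snd c p" using x by blast
    then have "p \<in> fst c" "p \<in> fst c'" using B by auto
    then have inv: "chart_inv c x = p" "chart_inv c' (?g x) = p"
      using p(2) by (simp_all add: chart_inv_chart[OF c(1)] chart_inv_chart[OF c(2)])
    show ?thesis unfolding vol_density_def inv
      using det_metric_matrix_change_chart[OF h c \<open>p \<in> fst c\<close> \<open>p \<in> fst c'\<close>]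
      by (simp add: real_sqrt_mult)
  qed
  have inS: "snd c ` (fst c \<inter> B) = ?S" "snd c' ` (fst c' \<inter> B) = ?T" using B by blast+
  have S: "?S \<in> sets borel" "?T \<in> sets borel"
    using borel_chart_image_of[OF c(1) B(1)] borel_chart_image_of[OF c(2) B(1)] inS by simp_all
  have meas: "(\<lambda>x. indicator (snd d ` B) x * vol_density h d x) \<in> borel_measurable borel"
    if "d \<in> A" "B \<subseteq> fst d" "snd d ` B \<in> sets borel" for d
  proof -
    have [measurable]: "(\<lambda>x. indicator (chart_image d) x * vol_density h d x) \<in> borel_measurable borel"
      "snd d ` B \<in> sets borel"
      using measurable_vol_density[OF h that(1)] that by auto
    have "(\<lambda>x. indicator (snd d ` B) x * vol_density h d x) =
        (\<lambda>x. indicator (snd d ` B) x * (indicator (chart_image d) x * vol_density h d x))"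
    proof (rule ext)
      have "snd d ` B \<subseteq> chart_image d" using that(2) by blast
      then show "indicator (snd d ` B) x * vol_density h d x =
          indicator (snd d ` B) x * (indicator (chart_image d) x * vol_density h d x)" for x
        by (auto split: split_indicator)
    qed
    then show ?thesis by simp
  qed
  have pS: "\<exists>p\<in>B. chart_inv c x = p \<and> snd c p = x" if "x \<in> ?S" for x
    using that chart_inv_chart[OF c(1)] B(2) by auto
  have pT: "\<exists>p\<in>B. chart_inv c' x = p \<and> snd c' p = x" if "x \<in> ?T" for x
    using that chart_inv_chart[OF c(2)] B(3) by auto
  have "(\<integral>\<^sup>+y\<in>?T. ennreal (vol_density h c' y) \<partial>lborel) =
      (\<integral>\<^sup>+x\<in>?S. ennreal (\<bar>det (matrix (?g' x))\<bar> * vol_density h c' (?g x)) \<partial>lborel)"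
  proof (rule nn_integral_change_of_variables[where h="?h" and h'="?h'"])
    show "(\<lambda>x. indicator ?T x * vol_density h c' x) \<in> borel_measurable borel"
      using meas[OF c(2) B(3) S(2)] .
    have "(\<lambda>x. indicator ?S x * (\<bar>det (matrix (?g' x))\<bar> * vol_density h c' (?g x))) =
        (\<lambda>x. indicator ?S x * vol_density h c x)"
      using dens by (auto simp: indicator_def simp del: o_apply)
    then show "(\<lambda>x. indicator ?S x * (\<bar>det (matrix (?g' x))\<bar> * vol_density h c' (?g x))) \<in> borel_measurable borel"
      using meas[OF c(1) B(2) S(1)] by simp
    show "(?g has_derivative ?g' x) (at x)" if asm: "x \<in> ?S" for x
    proof -
      obtain p where p: "p \<in> B" "chart_inv c x = p" "snd c p = x" using pS[OF asm] by blast
      then have "p \<in> fst c" "p \<in> fst c'" using B by auto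
      then show ?thesis using transition_has_derivative[OF c, of p] p by simp
    qed
    show "(?h has_derivative ?h' y) (at y)" if asm: "y \<in> ?T" for y
    proof -
      obtain p where p: "p \<in> B" "chart_inv c' y = p" "snd c' p = y" using pT[OF asm] by blast
      then have "p \<in> fst c" "p \<in> fst c'" using B by auto
      then show ?thesis using transition_has_derivative[OF c(2,1), of p] p by simp
    qed
    show "0 \<le> vol_density h c' y" if asm: "y \<in> ?T" for y
      using asm vol_density_pos[OF h c(2), of y] B by force
    show "?g x \<in> ?T \<and> ?h (?g x) = x" if asm: "x \<in> ?S" for x
    proof -
      obtain p where p: "p \<in> B" "chart_inv c x = p" "snd c p = x" using pS[OF asm] by blast
      then have "p \<in> fst c'" using B by auto
      then show ?thesis using p chart_inv_chart[OF c(2)] by simp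
    qed
    show "?h y \<in> ?S \<and> ?g (?h y) = y" if asm: "y \<in> ?T" for y
    proof -
      obtain p where p: "p \<in> B" "chart_inv c' y = p" "snd c' p = y" using pT[OF asm] by blast
      then have "p \<in> fst c" using B by auto
      then show ?thesis using p chart_inv_chart[OF c(1)] by simp
    qed
    show "?h' y \<circ> ?g' (?h y) = id" if asm: "y \<in> ?T" for y
    proof -
      obtain p where p: "p \<in> B" "chart_inv c' y = p" "snd c' p = y" using pT[OF asm] by blast
      have pc: "p \<in> fst c" "p \<in> fst c'" using p B by auto
      then have "chart_inv c (?h y) = p" using p chart_inv_chart[OF c(1)] by simp
      moreover have "transition_deriv c' c p (transition_deriv c c' p \<xi>) = \<xi>" for \<xi>
        using transition_deriv_cocycle[OF c c(1) pc pc(1)] transition_deriv_id[OF c(1) pc(1)] by simp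
      ultimately show ?thesis using p by (simp add: fun_eq_iff)
    qed
  qed (use S in auto)
  also have "\<dots> = (\<integral>\<^sup>+x\<in>?S. ennreal (vol_density h c x) \<partial>lborel)"
    using dens by (intro nn_integral_cong) (auto simp: indicator_def simp del: o_apply)
  finally show ?thesis
    using emeasure_chart_volume_subset[OF h c(1) B(1,2)] emeasure_chart_volume_subset[OF h c(2) B(1,3)] by simp
qed

definition is_volume :: "('a, 'm) metric \<Rightarrow> 'a measure \<Rightarrow> bool" where
  "is_volume h M \<longleftrightarrow> sets M = sets borel \<and>
     (\<forall>c\<in>A. \<forall>B\<in>sets borel. B \<subseteq> fst c \<longrightarrow> emeasure M B = emeasure (chart_volume h c) B)"

lemma volume_measure_alt:
  assumes "C1_metric h"
  shows "volume_measure A h = (THE M. is_volume h M)"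
  unfolding volume_measure_def is_volume_def vol_density_def[symmetric]
  by (rule arg_cong[where f=The], rule ext) (use assms in \<open>auto simp: emeasure_chart_volume_subset simp del: split_paired_All\<close>)

text \<open>Finitely many charts cover the manifold; repeating them in a sequence makes the disjointing
  operation on sequences of sets available.\<close>

lemma chart_sequence:
  obtains e :: "nat \<Rightarrow> ('a, 'm) chart" where "range e \<subseteq> A" "(\<Union>i. fst (e i)) = UNIV"
proof -
  have "\<And>U. U \<in> fst ` A \<Longrightarrow> open U" "UNIV \<subseteq> \<Union> (fst ` A)"
    using open_chart chart_at by (auto simp del: split_paired_All, metis UN_iff fst_conv)
  then obtain C where C: "C \<subseteq> A" "finite C" "(\<Union>c\<in>C. fst c) = UNIV"
    using compactE_image[OF compact_UNIV, of A fst] open_chart by (metis top.extremum_uniqueI)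
  then have "C \<noteq> {}" by auto
  then have ran: "range (from_nat_into C) = C" using C(2) by (simp add: countable_finite range_from_nat_into)
  show ?thesis
  proof (rule that)
    show "range (from_nat_into C) \<subseteq> A" using ran C(1) by blast
    have "(\<Union>i. fst (from_nat_into C i)) = (\<Union>c\<in>range (from_nat_into C). fst c)" by blast
    then show "(\<Union>i. fst (from_nat_into C i)) = UNIV" using ran C(3) by simp
  qed
qed

text \<open>A Borel set splits into countably many disjoint pieces, each inside one chart, where the
  defining formula prescribes the measure.\<close>

lemma is_volume_unique:
  assumes "is_volume h M" "is_volume h M'"
  shows "M = M'"
proof (rule measure_eqI)
  show sets: "sets M = sets M'" using assms by (simp add: is_volume_def)
  fix X assume "X \<in> sets M"
  then have X: "X \<in> sets borel" using assms by (simp add: is_volume_def)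
  obtain e :: "nat \<Rightarrow> ('a, 'm) chart" where eA: "range e \<subseteq> A" and eU: "(\<Union>i. fst (e i)) = UNIV"
    by (rule chart_sequence)
  have e: "e i \<in> A" for i using eA by blast
  let ?P = "\<lambda>i. X \<inter> disjointed (\<lambda>i. fst (e i)) i"
  have "range (\<lambda>i. fst (e i)) \<subseteq> sets borel" using e borel_chart by blast
  then have P: "?P i \<in> sets borel" for i using X sets.range_disjointed_sets by blast
  have dis: "disjoint_family ?P"
    using disjoint_family_disjointed[of "\<lambda>i. fst (e i)"] by (auto simp: disjoint_family_on_def)
  have U: "(\<Union>i. ?P i) = X"
    using UN_disjointed_eq[of "\<lambda>i. fst (e i)"] eU by auto
  have "emeasure N X = (\<Sum>i. emeasure (chart_volume h (e i)) (?P i))" if N: "is_volume h N" for N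
  proof -
    have "range ?P \<subseteq> sets N" using P N by (auto simp: is_volume_def)
    then have "emeasure N X = (\<Sum>i. emeasure N (?P i))" using suminf_emeasure[OF _ dis] U by metis
    also have "\<dots> = (\<Sum>i. emeasure (chart_volume h (e i)) (?P i))"
    proof (rule suminf_cong)
      fix i
      have "?P i \<subseteq> fst (e i)" using disjointed_subset[of "\<lambda>i. fst (e i)"] by blast
      then show "emeasure N (?P i) = emeasure (chart_volume h (e i)) (?P i)"
        using N P e unfolding is_volume_def by blast
    qed
    finally show ?thesis .
  qed
  then show "emeasure M X = emeasure M' X" using assms by simp
qed

text \<open>Gluing: each chart contributes its own volume on its piece of the decomposition. Agreement on
  overlaps shows that the sum has the prescribed value on subsets of every chart.\<close>

lemma is_volume_exists:
  assumes h: "C1_metric h"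
  shows "\<exists>M. is_volume h M"
proof -
  obtain e :: "nat \<Rightarrow> ('a, 'm) chart" where eA: "range e \<subseteq> A" and eU: "(\<Union>i. fst (e i)) = UNIV"
    by (rule chart_sequence)
  have e: "e i \<in> A" for i using eA by blast
  let ?P = "disjointed (\<lambda>i. fst (e i))"
  have "range (\<lambda>i. fst (e i)) \<subseteq> sets borel" using e borel_chart by blast
  then have P: "?P i \<in> sets borel" for i using sets.range_disjointed_sets by blast
  have Pe: "?P i \<subseteq> fst (e i)" for i using disjointed_subset .
  \<comment> \<open>The sum over the pieces is written as an integral, so that countable additivity is the
    exchange of a series with a nonnegative integral.\<close>
  let ?\<mu> = "\<lambda>B. \<integral>\<^sup>+i. emeasure (chart_volume h (e i)) (B \<inter> ?P i) \<partial>count_space UNIV"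
  define M where "M = measure_of UNIV (sets borel) ?\<mu>"
  have sets: "sets M = sets borel"
    unfolding M_def using sets.sigma_sets_eq[of borel] by (subst sets_measure_of) auto
  have ca: "countably_additive (sets borel) ?\<mu>"
  proof (rule countably_additiveI)
    fix B :: "nat \<Rightarrow> 'a set"
    assume B: "range B \<subseteq> sets borel" "disjoint_family B"
    have "(\<Sum>j. ?\<mu> (B j)) = (\<integral>\<^sup>+i. (\<Sum>j. emeasure (chart_volume h (e i)) (B j \<inter> ?P i)) \<partial>count_space UNIV)"
      by (subst nn_integral_suminf) auto
    also have "\<dots> = ?\<mu> (\<Union>j. B j)"
    proof (rule nn_integral_cong)
      fix i
      have "disjoint_family (\<lambda>j. B j \<inter> ?P i)" using B(2) by (auto simp: disjoint_family_on_def)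
      moreover have "range (\<lambda>j. B j \<inter> ?P i) \<subseteq> sets (chart_volume h (e i))" using B(1) P by auto
      ultimately have "(\<Sum>j. emeasure (chart_volume h (e i)) (B j \<inter> ?P i)) =
          emeasure (chart_volume h (e i)) (\<Union>j. B j \<inter> ?P i)"
        using suminf_emeasure by blast
      then show "(\<Sum>j. emeasure (chart_volume h (e i)) (B j \<inter> ?P i)) =
          emeasure (chart_volume h (e i)) ((\<Union>j. B j) \<inter> ?P i)" by simp
    qed
    finally show "(\<Sum>j. ?\<mu> (B j)) = ?\<mu> (\<Union>j. B j)" .
  qed
  have em: "emeasure M B = ?\<mu> B" if "B \<in> sets borel" for B
    using emeasure_measure_of[OF M_def, of B] ca that sets by (auto simp: positive_def)
  have "emeasure M B = emeasure (chart_volume h c) B"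
    if c: "c \<in> A" and B: "B \<in> sets borel" "B \<subseteq> fst c" for c B
  proof -
    have "emeasure M B = (\<integral>\<^sup>+i. emeasure (chart_volume h c) (B \<inter> ?P i) \<partial>count_space UNIV)"
      unfolding em[OF B(1)]
    proof (rule nn_integral_cong)
      fix i
      show "emeasure (chart_volume h (e i)) (B \<inter> ?P i) = emeasure (chart_volume h c) (B \<inter> ?P i)"
        using Pe[of i] B P by (intro chart_volume_agree h c e) auto
    qed
    also have "\<dots> = (\<Sum>i. emeasure (chart_volume h c) (B \<inter> ?P i))" by (rule nn_integral_count_space_nat)
    also have "\<dots> = emeasure (chart_volume h c) (\<Union>i. B \<inter> ?P i)"
    proof (rule suminf_emeasure)
      show "range (\<lambda>i. B \<inter> ?P i) \<subseteq> sets (chart_volume h c)" using B P by auto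
      show "disjoint_family (\<lambda>i. B \<inter> ?P i)"
        using disjoint_family_disjointed[of "\<lambda>i. fst (e i)"] by (auto simp: disjoint_family_on_def)
    qed
    also have "(\<Union>i. B \<inter> ?P i) = B"
      using UN_disjointed_eq[of "\<lambda>i. fst (e i)"] eU by auto
    finally show ?thesis .
  qed
  then show ?thesis using sets unfolding is_volume_def by blast
qed

lemma is_volume_volume_measure: "C1_metric h \<Longrightarrow> is_volume h (volume_measure A h)"
  using theI'[of "is_volume h"] is_volume_exists is_volume_unique volume_measure_alt by metis

lemma sets_volume_measure: "C1_metric h \<Longrightarrow> sets (volume_measure A h) = sets borel"
  using is_volume_volume_measure is_volume_def by blast

lemma emeasure_volume_chart:
  assumes "C1_metric h" "c \<in> A" "B \<in> sets borel" "B \<subseteq> fst c"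
  shows "emeasure (volume_measure A h) B = emeasure (chart_volume h c) B"
  using is_volume_volume_measure[OF assms(1)] assms(2-4) unfolding is_volume_def by blast

text \<open>In this form the transfer of integrals between the manifold and a chart is an instance of
  integration against densities and image measures.\<close>

lemma chart_volume_eq_density:
  assumes h: "C1_metric h" and c: "c \<in> A"
  shows "chart_volume h c = density (volume_measure A h) (\<lambda>p. ennreal (indicator (fst c) p))"
proof (rule measure_eqI)
  show "sets (chart_volume h c) = sets (density (volume_measure A h) (\<lambda>p. ennreal (indicator (fst c) p)))"
    by (simp add: sets_volume_measure[OF h])
  fix B assume "B \<in> sets (chart_volume h c)"
  then have B: "B \<in> sets borel" by simp
  have [measurable_cong]: "sets (volume_measure A h) = sets borel" by (rule sets_volume_measure[OF h])
  have "emeasure (density (volume_measure A h) (\<lambda>p. ennreal (indicator (fst c) p))) B =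
      (\<integral>\<^sup>+p. indicator (fst c \<inter> B) p \<partial>volume_measure A h)"
  proof (subst emeasure_density)
    show "(\<integral>\<^sup>+p. ennreal (indicator (fst c) p) * indicator B p \<partial>volume_measure A h) =
        (\<integral>\<^sup>+p. indicator (fst c \<inter> B) p \<partial>volume_measure A h)"
      by (rule nn_integral_cong) (simp split: split_indicator)
  qed (use B borel_chart[OF c] in auto)
  also have "\<dots> = emeasure (volume_measure A h) (fst c \<inter> B)"
    using B borel_chart[OF c] by (intro nn_integral_indicator) (auto simp: sets_volume_measure[OF h])
  also have "\<dots> = emeasure (chart_volume h c) (fst c \<inter> B)"
    using B borel_chart[OF c] by (intro emeasure_volume_chart h c) auto
  also have "\<dots> = emeasure (chart_volume h c) B"
    using emeasure_chart_volume[OF h c] B borel_chart[OF c] by (simp add: Int_absorb)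
  finally show "emeasure (chart_volume h c) B =
      emeasure (density (volume_measure A h) (\<lambda>p. ennreal (indicator (fst c) p))) B" by simp
qed

lemma
  fixes \<theta> :: "'a \<Rightarrow> real"
  assumes h: "C1_metric h" and c: "c \<in> A" and \<theta>: "\<theta> \<in> borel_measurable borel"
    and supp: "\<And>p. p \<notin> fst c \<Longrightarrow> \<theta> p = 0"
  shows integral_volume_chart: "(\<integral>p. \<theta> p \<partial>volume_measure A h) =
      (\<integral>x. indicator (chart_image c) x * vol_density h c x * \<theta> (chart_inv c x) \<partial>lborel)"
    and integrable_volume_chart: "integrable (volume_measure A h) \<theta> \<longleftrightarrow>
      integrable lborel (\<lambda>x. indicator (chart_image c) x * vol_density h c x * \<theta> (chart_inv c x))"
proof -
  let ?e = "\<lambda>x. if x \<in> chart_image c then chart_inv c x else undefined"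
  let ?w = "\<lambda>x. indicator (chart_image c) x * vol_density h c x"
  note [measurable] = measurable_chart_inv[OF c, of undefined] \<theta> measurable_vol_density[OF h c] borel_chart[OF c]
  have [measurable_cong]: "sets (volume_measure A h) = sets borel" by (rule sets_volume_measure[OF h])
  have e: "?w x * \<theta> (?e x) = ?w x * \<theta> (chart_inv c x)" for x by (simp add: indicator_def)
  have \<theta>': "\<theta> = (\<lambda>p. indicator (fst c) p * \<theta> p)"
  proof (rule ext)
    show "\<theta> p = indicator (fst c) p * \<theta> p" for p using supp[of p] by (cases "p \<in> fst c") simp_all
  qed
  have "(\<integral>p. \<theta> p \<partial>volume_measure A h) = (\<integral>p. indicator (fst c) p * \<theta> p \<partial>volume_measure A h)"
    using \<theta>' by metis
  also have "\<dots> = (\<integral>p. \<theta> p \<partial>chart_volume h c)"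
    unfolding chart_volume_eq_density[OF h c] by (subst integral_density) auto
  also have "\<dots> = (\<integral>x. ?w x * \<theta> (?e x) \<partial>lborel)"
    unfolding chart_volume_def using vol_density_nonneg[OF h c]
    by (subst integral_distr) (auto simp: integral_density)
  finally show "(\<integral>p. \<theta> p \<partial>volume_measure A h) = (\<integral>x. ?w x * \<theta> (chart_inv c x) \<partial>lborel)"
    unfolding e .
  have "integrable (volume_measure A h) \<theta> \<longleftrightarrow> integrable (volume_measure A h) (\<lambda>p. indicator (fst c) p * \<theta> p)"
    using \<theta>' by metis
  also have "\<dots> \<longleftrightarrow> integrable (chart_volume h c) \<theta>"
    unfolding chart_volume_eq_density[OF h c] by (subst integrable_density) auto
  also have "\<dots> \<longleftrightarrow> integrable lborel (\<lambda>x. ?w x * \<theta> (?e x))"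
    unfolding chart_volume_def using vol_density_nonneg[OF h c]
    by (subst integrable_distr_eq) (auto simp: integrable_density)
  finally show "integrable (volume_measure A h) \<theta> \<longleftrightarrow> integrable lborel (\<lambda>x. ?w x * \<theta> (chart_inv c x))"
    unfolding e .
qed

text \<open>The density is bounded on compact balls, so every point has a neighbourhood of finite volume,
  and finitely many of these cover the manifold.\<close>

lemma finite_measure_volume:
  assumes h: "C1_metric h"
  shows "finite_measure (volume_measure A h)"
proof -
  let ?M = "volume_measure A h"
  have sp: "space ?M = UNIV" using sets_eq_imp_space_eq[OF sets_volume_measure[OF h]] by simp
  have "\<exists>W. open W \<and> p \<in> W \<and> emeasure ?M W < \<infinity>" for p
  proof -
    obtain c where c: "c \<in> A" "p \<in> fst c" using chart_at .
    obtain r where r: "r > 0" "cball (snd c p) r \<subseteq> chart_image c"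
      using open_chart_image[OF c(1)] c(2) by (meson imageI open_contains_cball)
    have "continuous_on (cball (snd c p) r) (vol_density h c)"
      using Ck_on_imp_continuous[OF Ck_on_vol_density[OF h c(1)]] r(2) continuous_on_subset by blast
    then have "bounded (vol_density h c ` cball (snd c p) r)"
      by (intro compact_imp_bounded compact_continuous_image) auto
    then obtain b where b: "\<And>x. x \<in> cball (snd c p) r \<Longrightarrow> vol_density h c x \<le> b"
      unfolding bounded_iff by (metis abs_le_D1 imageI real_norm_def)
    have ball: "ball (snd c p) r \<subseteq> chart_image c" using r(2) by auto
    let ?W = "fst c \<inter> snd c -` ball (snd c p) r"
    have W: "open ?W"
      using continuous_open_preimage[OF continuous_on_chart open_chart] c by simp
    have im: "snd c ` ?W = ball (snd c p) r" using ball by auto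
    have "emeasure ?M ?W = emeasure (chart_volume h c) ?W"
      by (rule emeasure_volume_chart[OF h c(1) borel_open[OF W] Int_lower1])
    also have "\<dots> = (\<integral>\<^sup>+x\<in>ball (snd c p) r. ennreal (vol_density h c x) \<partial>lborel)"
      using emeasure_chart_volume_subset[OF h c(1) borel_open[OF W] Int_lower1] im by simp
    also have "\<dots> \<le> (\<integral>\<^sup>+x\<in>ball (snd c p) r. ennreal b \<partial>lborel)"
      using b by (intro nn_integral_mono) (auto simp: indicator_def intro!: ennreal_leI)
    also have "\<dots> < \<infinity>"
      using emeasure_lborel_ball_finite[of "snd c p" r]
      by (subst nn_integral_cmult_indicator) (auto simp: ennreal_mult_less_top)
    finally have "emeasure ?M ?W < \<infinity>" .
    moreover have "p \<in> ?W" using c(2) r(1) by simp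
    ultimately show ?thesis using W by blast
  qed
  then have "\<forall>p. \<exists>W. open W \<and> p \<in> W \<and> emeasure ?M W < \<infinity>" by blast
  then obtain W where W': "\<forall>p. open (W p) \<and> p \<in> W p \<and> emeasure ?M (W p) < \<infinity>"
    using choice[of "\<lambda>p W. open W \<and> p \<in> W \<and> emeasure ?M W < \<infinity>"] by blast
  then have W: "\<And>p. open (W p)" "\<And>p. p \<in> W p" "\<And>p. emeasure ?M (W p) < \<infinity>" by blast+
  have U: "UNIV \<subseteq> (\<Union>p\<in>UNIV. W p)" using W(2) by blast
  obtain D where D: "D \<subseteq> UNIV" "finite D" "UNIV \<subseteq> (\<Union>p\<in>D. W p)"
    by (rule compactE_image[OF compact_UNIV W(1) U])
  have Ws: "W p \<in> sets ?M" for p unfolding sets_volume_measure[OF h] using borel_open[OF W(1)] .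
  have "(\<Union>p\<in>D. W p) = UNIV" using D(3) by blast
  then have "emeasure ?M UNIV = emeasure ?M (\<Union>p\<in>D. W p)" by simp
  also have "\<dots> \<le> (\<Sum>p\<in>D. emeasure ?M (W p))"
    by (rule emeasure_subadditive_finite[OF D(2)]) (use Ws in blast)
  also have "\<dots> < \<infinity>" using W(3) by (simp add: ennreal_sum_less_top[OF D(2)])
  finally show ?thesis unfolding sp[symmetric] by (intro finite_measureI) simp
qed

lemma integrable_volume_continuous:
  fixes \<theta> :: "'a \<Rightarrow> real"
  assumes h: "C1_metric h" and \<theta>: "continuous_on UNIV \<theta>"
  shows "integrable (volume_measure A h) \<theta>"
proof -
  interpret finite_measure "volume_measure A h" by (rule finite_measure_volume[OF h])
  have "bounded (range \<theta>)" using compact_continuous_image[OF \<theta> compact_UNIV] compact_imp_bounded by blast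
  then obtain b where "\<And>p. norm (\<theta> p) \<le> b" by (auto simp: bounded_iff)
  moreover have "\<theta> \<in> borel_measurable (volume_measure A h)"
    using borel_measurable_continuous_onI[OF \<theta>] measurable_cong_sets[OF sets_volume_measure[OF h] refl] by blast
  ultimately show ?thesis by (intro integrable_const_bound[of _ b]) auto
qed

end

section \<open>Integrals of derivatives of compactly supported functions\<close>

lemma integrable_lborel_compact_support:
  fixes f :: "'v::euclidean_space \<Rightarrow> real"
  assumes "compact K" "continuous_on UNIV f" "\<And>x. x \<notin> K \<Longrightarrow> f x = 0"
  shows "integrable lborel f"
proof -
  have "integrable lborel (\<lambda>x. indicator K x *\<^sub>R f x)"
    using assms(1,2) by (intro borel_integrable_compact) (auto intro: continuous_on_subset)
  moreover have "(\<lambda>x. indicator K x *\<^sub>R f x) = f"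
  proof (rule ext)
    show "indicator K x *\<^sub>R f x = f x" for x using assms(3)[of x] by (cases "x \<in> K") simp_all
  qed
  ultimately show ?thesis by simp
qed

lemma frechet_derivative_zero_off:
  fixes f :: "'v::real_normed_vector \<Rightarrow> 'w::real_normed_vector"
  assumes "closed K" "\<And>x. x \<notin> K \<Longrightarrow> f x = 0" "x \<notin> K"
  shows "frechet_derivative f (at x) u = 0"
proof -
  have "(f has_derivative (\<lambda>_. 0)) (at x)"
  proof (rule has_derivative_transform_within_open[OF has_derivative_const])
    show "open (- K)" using assms(1) by auto
  qed (use assms in auto)
  from frechet_derivative_at[OF this] show ?thesis by metis
qed

lemma integral_lborel_shift:
  fixes f :: "'v::euclidean_space \<Rightarrow> real"
  assumes "f \<in> borel_measurable borel"
  shows "(\<integral>x. f (c + x) \<partial>lborel) = (\<integral>x. f x \<partial>lborel)"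
proof -
  have "(\<integral>x. f x \<partial>lborel) = (\<integral>x. f x \<partial>distr lborel borel ((+) c))" by (simp add: lborel_distr_plus)
  also have "\<dots> = (\<integral>x. f (c + x) \<partial>lborel)" using assms by (subst integral_distr) auto
  finally show ?thesis by simp
qed

text \<open>By translation invariance every difference quotient integrates to zero, and the quotients
  converge dominatedly to the derivative.\<close>

lemma integral_derivative_zero:
  fixes Y :: "'v::euclidean_space \<Rightarrow> real"
  assumes Y: "Ck_on 1 Y UNIV" and K: "compact K" "\<And>x. x \<notin> K \<Longrightarrow> Y x = 0"
  shows "(\<integral>x. frechet_derivative Y (at x) e \<partial>lborel) = 0"
proof -
  let ?D = "\<lambda>x. frechet_derivative Y (at x) e"
  let ?t = "\<lambda>n::nat. 1 / (real n + 1)"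
  let ?Q = "\<lambda>n x. (Y (?t n *\<^sub>R e + x) - Y x) / ?t n"
  have contY: "continuous_on UNIV Y" using Ck_on_imp_continuous[OF Y] .
  then have [measurable]: "Y \<in> borel_measurable borel" by (rule borel_measurable_continuous_onI)
  have intY: "integrable lborel Y" by (rule integrable_lborel_compact_support[OF K(1) contY K(2)])
  have contD: "continuous_on UNIV ?D" using Y by simp
  then have [measurable]: "?D \<in> borel_measurable borel" by (rule borel_measurable_continuous_onI)
  have D0: "?D x = 0" if "x \<notin> K" for x
    using frechet_derivative_zero_off[OF compact_imp_closed[OF K(1)] K(2) that] .
  have der: "((\<lambda>s. Y (s *\<^sub>R e + x)) has_real_derivative ?D (s *\<^sub>R e + x)) (at s)" for s x
  proof -
    have DY: "(Y has_derivative frechet_derivative Y (at (s *\<^sub>R e + x))) (at (s *\<^sub>R e + x))"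
      using Ck_on_has_derivative[of 0 Y UNIV] Y by simp
    have "((\<lambda>s. s *\<^sub>R e + x) has_derivative (\<lambda>u. u *\<^sub>R e)) (at s)"
      by (auto intro!: derivative_eq_intros)
    from has_derivative_compose[OF this DY]
    have "((\<lambda>s. Y (s *\<^sub>R e + x)) has_derivative (\<lambda>u. frechet_derivative Y (at (s *\<^sub>R e + x)) (u *\<^sub>R e))) (at s)" .
    moreover have "frechet_derivative Y (at (s *\<^sub>R e + x)) (u *\<^sub>R e) = ?D (s *\<^sub>R e + x) * u" for u
      using linear_scale[OF has_derivative_linear[OF DY]] by (simp add: mult.commute)
    ultimately show ?thesis by (simp add: has_field_derivative_def)
  qed
  obtain B where B: "B > 0" "\<And>x. \<bar>?D x\<bar> \<le> B"
  proof -
    have "bounded (?D ` K)"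
      using contD K(1) continuous_on_subset by (intro compact_imp_bounded compact_continuous_image) blast+
    then obtain b where b: "b > 0" "\<And>x. x \<in> K \<Longrightarrow> \<bar>?D x\<bar> \<le> b"
      unfolding bounded_pos by auto
    have "\<bar>?D x\<bar> \<le> b" for x using b D0[of x] by (cases "x \<in> K") simp_all
    then show ?thesis using that b(1) by blast
  qed
  obtain R where R: "\<And>x. x \<in> K \<Longrightarrow> norm x \<le> R" using compact_imp_bounded[OF K(1)] by (auto simp: bounded_iff)
  let ?K = "cball 0 (R + norm e) :: 'v set"
  have lim: "(\<lambda>n. \<integral>x. ?Q n x \<partial>lborel) \<longlonglongrightarrow> (\<integral>x. ?D x \<partial>lborel)"
  proof (rule integral_dominated_convergence[where w="\<lambda>x. B * indicator ?K x"])
    show "integrable lborel (\<lambda>x. B * indicator ?K x)"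
      using emeasure_lborel_cball_finite[of "0::'v" "R + norm e"]
      by (intro integrable_mult_right integrable_real_indicator) auto
    show "AE x in lborel. (\<lambda>n. ?Q n x) \<longlonglongrightarrow> ?D x"
    proof (rule AE_I2)
      fix x
      have "((\<lambda>h. (Y (h *\<^sub>R e + x) - Y x) / h) \<longlongrightarrow> ?D x) (at 0)"
        using der[of x 0] by (simp add: DERIV_def)
      moreover have "filterlim ?t (at 0) sequentially"
        unfolding filterlim_at using LIMSEQ_inverse_real_of_nat
        by (auto simp: inverse_eq_divide add.commute)
      ultimately show "(\<lambda>n. ?Q n x) \<longlonglongrightarrow> ?D x" by (rule filterlim_compose)
    qed
    show "AE x in lborel. norm (?Q n x) \<le> B * indicator ?K x" for n
    proof (rule AE_I2)
      fix x
      have t: "0 < ?t n" "?t n \<le> 1" by simp_all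
      show "norm (?Q n x) \<le> B * indicator ?K x"
      proof (cases "x \<in> ?K")
        case True
        obtain z where "Y (?t n *\<^sub>R e + x) - Y (0 *\<^sub>R e + x) = (?t n - 0) * ?D (z *\<^sub>R e + x)"
          using MVT2[OF t(1), of "\<lambda>s. Y (s *\<^sub>R e + x)" "\<lambda>s. ?D (s *\<^sub>R e + x)"] der by metis
        then have "?Q n x = ?D (z *\<^sub>R e + x)" using t(1) by (simp add: field_simps)
        then show ?thesis using B(2) True by simp
      next
        case False
        then have big: "norm x > R + norm e" by simp
        have "norm (?t n *\<^sub>R e) \<le> norm e" using t mult_right_mono[OF t(2), of "norm e"] by simp
        then have "norm (?t n *\<^sub>R e + x) > R"
          using big norm_triangle_ineq2[of x "- (?t n *\<^sub>R e)"] by (simp add: add.commute)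
        moreover have "norm x > R" using big norm_ge_zero[of e] by linarith
        ultimately have "Y (?t n *\<^sub>R e + x) = 0" "Y x = 0" using R K(2) not_le by blast+
        then show ?thesis using False by simp
      qed
    qed
  qed auto
  have "(\<integral>x. ?Q n x \<partial>lborel) = 0" for n
  proof -
    have "integrable lborel (\<lambda>x. Y (?t n *\<^sub>R e + x))"
    proof (rule integrable_lborel_compact_support)
      show "compact ((\<lambda>x. x - ?t n *\<^sub>R e) ` K)"
        using K(1) by (intro compact_continuous_image continuous_intros)
      show "continuous_on UNIV (\<lambda>x. Y (?t n *\<^sub>R e + x))"
        by (intro continuous_on_compose2[OF contY] continuous_intros) auto
      show "Y (?t n *\<^sub>R e + x) = 0" if "x \<notin> (\<lambda>x. x - ?t n *\<^sub>R e) ` K" for x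
        using that K(2)[of "?t n *\<^sub>R e + x"] by (force simp: image_iff)
    qed
    then have "(\<integral>x. Y (?t n *\<^sub>R e + x) - Y x \<partial>lborel) = 0"
      using intY integral_lborel_shift[of Y "?t n *\<^sub>R e"] by simp
    then show ?thesis by simp
  qed
  then show ?thesis using LIMSEQ_unique[OF lim] by simp
qed

section \<open>Bump functions and partitions of unity\<close>

context compact_manifold
begin

text \<open>The bump is a radial function in one chart, extended by zero. It is smooth because any other
  chart domain is the union of two open sets: the overlap, where it is composed with a transition map,
  and the complement of the compact support, where it vanishes.\<close>

lemma smooth_bump:
  assumes "open W" "p \<in> W"
  obtains \<phi> :: "'a \<Rightarrow> real" and c K where "smooth_map A \<phi>" "\<forall>q. 0 \<le> \<phi> q" "0 < \<phi> p"
    "c \<in> A" "compact K" "K \<subseteq> W \<inter> fst c" "\<forall>q. q \<notin> K \<longrightarrow> \<phi> q = 0"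
proof -
  obtain c where c: "c \<in> A" "p \<in> fst c" using chart_at .
  let ?x = "snd c p"
  have "open (snd c ` (fst c \<inter> W))" by (rule open_chart_image_of[OF c(1) assms(1)])
  moreover have "?x \<in> snd c ` (fst c \<inter> W)" using c assms by blast
  ultimately obtain r where r: "r > 0" "cball ?x r \<subseteq> snd c ` (fst c \<inter> W)"
    by (meson open_contains_cball)
  have sub: "cball ?x r \<subseteq> chart_image c" using r(2) by blast
  define K where "K = chart_inv c ` cball ?x r"
  have K: "compact K" unfolding K_def
    using continuous_on_subset[OF continuous_on_chart_inv[OF c(1)] sub] by (intro compact_continuous_image) auto
  have Ksub: "K \<subseteq> W \<inter> fst c"
  proof
    fix q assume "q \<in> K"
    then obtain x where "x \<in> cball ?x r" "q = chart_inv c x" unfolding K_def by blast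
    then obtain q' where "q' \<in> fst c" "q' \<in> W" "q = chart_inv c (snd c q')" using r(2) by blast
    then show "q \<in> W \<inter> fst c" using chart_inv_chart[OF c(1)] by simp
  qed
  define b where "b = (\<lambda>x. flat 0 (r\<^sup>2 - (x - ?x) \<bullet> (x - ?x)))"
  define \<phi> where "\<phi> q = (if q \<in> fst c then b (snd c q) else 0)" for q
  have off: "\<phi> q = 0" if "q \<notin> K" for q
  proof (cases "q \<in> fst c")
    case True
    have "snd c q \<notin> cball ?x r"
    proof
      assume "snd c q \<in> cball ?x r"
      then have "chart_inv c (snd c q) \<in> K" unfolding K_def by blast
      then show False using that chart_inv_chart[OF c(1) True] by simp
    qed
    then have "r < norm (snd c q - ?x)" by (simp add: dist_norm norm_minus_commute)
    then have "r\<^sup>2 \<le> (snd c q - ?x) \<bullet> (snd c q - ?x)"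
      using r(1) unfolding power2_norm_eq_inner[symmetric] by (intro power_mono) auto
    then show ?thesis using True by (simp add: \<phi>_def b_def flat_def)
  qed (simp add: \<phi>_def)
  have Ck_b: "Ck_on k b UNIV" for k
    unfolding b_def by (rule Ck_on_compose[OF _ _ _ _ Ck_on_flat])
      (intro Ck_on_diff Ck_on_inner Ck_on_const Ck_on_ident | simp)+
  have "Ck_on k (\<phi> \<circ> chart_inv c') (chart_image c')" if c': "c' \<in> A" for k c'
  proof -
    let ?S = "snd c' ` (fst c' \<inter> fst c)" and ?T = "snd c' ` (fst c' \<inter> - K)"
    have op: "open ?S" "open ?T"
      using open_chart_image_of[OF c'] open_chart[OF c(1)] compact_imp_closed[OF K] by auto
    have "Ck_on k (\<lambda>x. b ((snd c \<circ> chart_inv c') x)) ?S"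
      by (rule Ck_on_compose[OF op(1) open_UNIV _ Ck_on_transition[OF c' c(1)] Ck_b]) auto
    then have "Ck_on k (\<phi> \<circ> chart_inv c') ?S"
      by (rule Ck_on_cong[OF op(1), rotated]) (use chart_inv_chart[OF c'] in \<open>auto simp: \<phi>_def\<close>)
    moreover have "Ck_on k (\<phi> \<circ> chart_inv c') ?T"
      by (rule Ck_on_cong[OF op(2) _ Ck_on_const[of k 0]])
        (use chart_inv_chart[OF c'] off in auto)
    moreover have "?S \<union> ?T = chart_image c'" using Ksub by blast
    ultimately show ?thesis using Ck_on_Un[OF op] by metis
  qed
  then have "smooth_map A \<phi>" unfolding smooth_map_def Ck_map_def by blast
  moreover have "0 \<le> \<phi> q" for q by (simp add: \<phi>_def b_def flat_nonneg)
  moreover have "0 < \<phi> p" using c(2) r(1) by (simp add: \<phi>_def b_def flat_def)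
  ultimately show ?thesis using that[of \<phi> c K] c K Ksub off by blast
qed

text \<open>Bumps around finitely many points, normalised by their sum.\<close>

lemma C1_partition_of_unity:
  obtains I :: "'a set" and \<rho> :: "'a \<Rightarrow> 'a \<Rightarrow> real" and c K where "finite I"
    "\<forall>i\<in>I. Ck_map A 1 (\<rho> i) \<and> c i \<in> A \<and> compact (K i) \<and> K i \<subseteq> fst (c i) \<and> (\<forall>q. q \<notin> K i \<longrightarrow> \<rho> i q = 0)"
    "\<forall>q. (\<Sum>i\<in>I. \<rho> i q) = 1"
proof -
  let ?R = "\<lambda>p (\<phi>, c, K). smooth_map A \<phi> \<and> (\<forall>q. 0 \<le> \<phi> q) \<and> (0::real) < \<phi> p \<and>
      c \<in> A \<and> compact K \<and> K \<subseteq> fst c \<and> (\<forall>q. q \<notin> K \<longrightarrow> \<phi> q = 0)"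
  have "\<exists>x. ?R p x" for p
  proof -
    obtain \<phi> :: "'a \<Rightarrow> real" and c K where "smooth_map A \<phi>" "\<forall>q. 0 \<le> \<phi> q" "0 < \<phi> p"
      "c \<in> A" "compact K" "K \<subseteq> UNIV \<inter> fst c" "\<forall>q. q \<notin> K \<longrightarrow> \<phi> q = 0"
      by (rule smooth_bump[OF open_UNIV UNIV_I])
    then have "?R p (\<phi>, c, K)" by simp
    then show ?thesis by blast
  qed
  then obtain X where X: "\<forall>p. ?R p (X p)" using choice[of ?R] by blast
  define \<phi> c K where "\<phi> p = fst (X p)" and "c p = fst (snd (X p))" and "K p = snd (snd (X p))" for p
  have R: "smooth_map A (\<phi> p)" "0 \<le> \<phi> p q" "0 < \<phi> p p" "c p \<in> A" "compact (K p)" "K p \<subseteq> fst (c p)"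
    "q \<notin> K p \<Longrightarrow> \<phi> p q = 0" for p q
    using spec[OF X, of p] by (auto simp: \<phi>_def c_def K_def split_beta)
  have C1: "Ck_map A 1 (\<phi> p)" for p using R(1) by (simp add: smooth_map_def)
  have op: "open {q. 0 < \<phi> p q}" for p
    using Ck_map_imp_continuous[OF C1] by (intro open_Collect_less) auto
  have cov: "UNIV \<subseteq> (\<Union>p\<in>UNIV. {q. 0 < \<phi> p q})" using R(3) by blast
  obtain I where I: "I \<subseteq> UNIV" "finite I" "UNIV \<subseteq> (\<Union>p\<in>I. {q. 0 < \<phi> p q})"
    by (rule compactE_image[OF compact_UNIV op cov])
  define S where "S q = (\<Sum>p\<in>I. \<phi> p q)" for q
  have S: "S q > 0" for q
  proof -
    obtain p where "p \<in> I" "0 < \<phi> p q" using I(3) by blast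
    then show ?thesis unfolding S_def using I(2) R(2) by (intro sum_pos2[of _ p]) auto
  qed
  define \<rho> where "\<rho> p q = \<phi> p q / S q" for p q
  have "Ck_map A 1 (\<rho> p)" for p
    unfolding Ck_map_def
  proof
    fix d assume d: "d \<in> A"
    have 1: "Ck_on 1 (\<lambda>x. \<phi> p (chart_inv d x)) (chart_image d)" for p
      using C1[of p] d by (auto simp: Ck_map_def o_def)
    have "Ck_on 1 (\<lambda>x. \<phi> p (chart_inv d x) / S (chart_inv d x)) (chart_image d)"
    proof (rule Ck_on_divide[OF open_chart_image[OF d] 1])
      show "Ck_on 1 (\<lambda>x. S (chart_inv d x)) (chart_image d)"
        unfolding S_def by (intro Ck_on_sum open_chart_image[OF d] 1)
      show "S (chart_inv d x) \<noteq> 0" for x using S[of "chart_inv d x"] by simp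
    qed
    then show "Ck_on 1 (\<rho> p \<circ> chart_inv d) (chart_image d)" by (simp add: \<rho>_def o_def)
  qed
  moreover have "(\<Sum>p\<in>I. \<rho> p q) = 1" for q
    using S[of q] unfolding \<rho>_def by (simp add: S_def flip: sum_divide_distrib)
  moreover have "\<rho> p q = 0" if "q \<notin> K p" for p q using R(7)[OF that] by (simp add: \<rho>_def)
  ultimately show ?thesis using that[of I \<rho> c K] I(2) R(4,5,6) by blast
qed

end

section \<open>The codifferential\<close>

text \<open>Numerators and denominator in Cramer's rule are determinants, hence polynomial in the data.\<close>

lemma Ck_on_cramer_solve:
  fixes M :: "'v::real_normed_vector \<Rightarrow> real^'n^'n"
  assumes "open S" "\<And>i j. Ck_on k (\<lambda>x. M x $ i $ j) S" "\<And>i. Ck_on k (\<lambda>x. b x $ i) S"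
    and "\<And>x. x \<in> S \<Longrightarrow> det (M x) \<noteq> 0"
  shows "Ck_on k (\<lambda>x. cramer_solve (M x) (b x) $ l) S"
proof -
  have "Ck_on k (\<lambda>x. (\<chi> i j. if j = l then b x $ i else M x $ i $ j) $ i $ j) S" for i j
    using assms(2,3) by (cases "j = l") simp_all
  then show ?thesis
    unfolding cramer_solve_def using assms by (simp add: Ck_on_divide Ck_on_det)
qed

context compact_manifold
begin

text \<open>A one-form is an arbitrary function on families of coordinate vectors; linearity and regularity
  are demanded on tangent vectors only.\<close>

definition C1_form :: "('a, 'm) one_form \<Rightarrow> bool" where
  "C1_form w \<longleftrightarrow> (\<forall>c\<in>A. (\<forall>p\<in>fst c. linear (\<lambda>\<xi>. w p (tv c p \<xi>))) \<and>
     (\<forall>\<xi>. Ck_on 1 (\<lambda>x. w (chart_inv c x) (tv c (chart_inv c x) \<xi>)) (chart_image c)))"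

lemma C1_formD:
  assumes "C1_form w" "c \<in> A"
  shows "p \<in> fst c \<Longrightarrow> linear (\<lambda>\<xi>. w p (tv c p \<xi>))"
    and "Ck_on 1 (\<lambda>x. w (chart_inv c x) (tv c (chart_inv c x) \<xi>)) (chart_image c)"
  using assms unfolding C1_form_def by blast+

lemma C1_form_differential:
  assumes "Ck_map A 2 f"
  shows "C1_form (differential A f)"
proof -
  have f: "Ck_map A (Suc 1) f" using assms by (simp add: numeral_2_eq_2)
  show ?thesis unfolding C1_form_def
    using linear_differential_tv[OF f] Ck_on_differential[OF f] by blast
qed

lemma sharp_eqI:
  assumes h: "C1_metric h" and c: "c \<in> A" "p \<in> fst c"
    and eq: "\<And>\<eta>. h p (tv c p \<xi>) (tv c p \<eta>) = \<alpha> (tv c p \<eta>)"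
  shows "sharp A h p \<alpha> = tv c p \<xi>"
  unfolding sharp_def
proof (rule the_equality)
  show "tv c p \<xi> \<in> tangent_space A p \<and> (\<forall>u'\<in>tangent_space A p. h p (tv c p \<xi>) u' = \<alpha> u')"
    using eq tangent_space_iff[OF c] by auto
next
  fix u assume u: "u \<in> tangent_space A p \<and> (\<forall>u'\<in>tangent_space A p. h p u u' = \<alpha> u')"
  then obtain \<eta> where \<eta>: "u = tv c p \<eta>" using tangent_space_iff[OF c] by blast
  let ?B = "\<lambda>\<xi> \<eta>. h p (tv c p \<xi>) (tv c p \<eta>)"
  note ip = C1_metricD(1)[OF h c]
  have "?B \<eta> \<theta> = ?B \<xi> \<theta>" for \<theta> using u eq \<eta> tv_in_tangent_space[OF c] by simp
  then have "?B (\<eta> - \<xi>) (\<eta> - \<xi>) = 0" using bilinear_lsub[OF is_inner_productD(1)[OF ip]] by simp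
  then have "\<eta> - \<xi> = 0" using is_inner_productD(3)[OF ip, of "\<eta> - \<xi>"] by force
  then show "u = tv c p \<xi>" using \<eta> by simp
qed

lemma sharp_solves:
  assumes h: "C1_metric h" and c: "c \<in> A" "p \<in> fst c" and \<alpha>: "linear (\<lambda>\<xi>. \<alpha> (tv c p \<xi>))"
  shows "h p (sharp A h p \<alpha>) (tv c p \<eta>) = \<alpha> (tv c p \<eta>)"
    and "sharp A h p \<alpha> = tv c p (cramer_solve (metric_matrix A h c p) (\<chi> i. \<alpha> (tv c p (axis i 1))))"
proof -
  let ?\<xi> = "cramer_solve (metric_matrix A h c p) (\<chi> i. \<alpha> (tv c p (axis i 1)))"
  have eq: "h p (tv c p ?\<xi>) (tv c p \<eta>) = \<alpha> (tv c p \<eta>)" for \<eta>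
    unfolding metric_matrix_eq_gram using gram_solve_eq[OF C1_metricD(1)[OF h c] \<alpha>] .
  show s: "sharp A h p \<alpha> = tv c p ?\<xi>" by (rule sharp_eqI[OF h c eq])
  show "h p (sharp A h p \<alpha>) (tv c p \<eta>) = \<alpha> (tv c p \<eta>)" unfolding s by (rule eq)
qed

text \<open>This leaves one Riesz representative to compute instead of two, and for \<open>\<beta> = d\<phi>\<close> it exhibits
  the inverse metric as a directional derivative of \<open>\<phi>\<close>, which is what can be integrated by parts.\<close>

lemma inverse_metric_eq:
  assumes h: "C1_metric h" and c: "c \<in> A" "p \<in> fst c"
    and \<alpha>: "linear (\<lambda>\<xi>. \<alpha> (tv c p \<xi>))" and \<beta>: "linear (\<lambda>\<xi>. \<beta> (tv c p \<xi>))"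
  shows "inverse_metric A h p \<alpha> \<beta> = \<beta> (sharp A h p \<alpha>)"
proof -
  obtain \<xi> \<eta> where s: "sharp A h p \<alpha> = tv c p \<xi>" "sharp A h p \<beta> = tv c p \<eta>"
    using sharp_solves(2)[OF h c \<alpha>] sharp_solves(2)[OF h c \<beta>] by blast
  then show ?thesis
    using sharp_solves(1)[OF h c \<beta>, of \<xi>] is_inner_productD(2)[OF C1_metricD(1)[OF h c], of \<xi> \<eta>]
    by (simp add: inverse_metric_def)
qed

definition sharp_coord ::
    "('a, 'm) metric \<Rightarrow> ('a, 'm) one_form \<Rightarrow> ('a, 'm) chart \<Rightarrow> (real, 'm) vec \<Rightarrow> (real, 'm) vec" where
  "sharp_coord h w c x = cramer_solve (metric_matrix A h c (chart_inv c x))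
     (\<chi> i. w (chart_inv c x) (tv c (chart_inv c x) (axis i 1)))"

lemma Ck_on_sharp_coord:
  assumes "C1_metric h" "c \<in> A" "C1_form w"
  shows "Ck_on 1 (\<lambda>x. sharp_coord h w c x $ i) (chart_image c)"
  unfolding sharp_coord_def
proof (rule Ck_on_cramer_solve[OF open_chart_image[OF assms(2)] C1_metricD(2)[OF assms(1,2)]])
  show "Ck_on 1 (\<lambda>x. (\<chi> i. w (chart_inv c x) (tv c (chart_inv c x) (axis i 1))) $ i) (chart_image c)" for i
    using C1_formD(2)[OF assms(3,2)] by simp
  show "det (metric_matrix A h c (chart_inv c x)) \<noteq> 0" if "x \<in> chart_image c" for x
    using det_metric_matrix_pos[OF assms(1,2) chart_inv_in[OF assms(2) that]] by simp
qed

lemma inverse_metric_differential_coord: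
  assumes h: "C1_metric h" and w: "C1_form w" and \<phi>: "Ck_map A 1 \<phi>" and c: "c \<in> A" "x \<in> chart_image c"
  shows "inverse_metric A h (chart_inv c x) (w (chart_inv c x)) (differential A \<phi> (chart_inv c x)) =
    (\<Sum>i\<in>UNIV. sharp_coord h w c x $ i * differential A \<phi> (chart_inv c x) (tv c (chart_inv c x) (axis i 1)))"
proof -
  let ?p = "chart_inv c x" and ?\<xi> = "sharp_coord h w c x"
  note p = chart_inv_in[OF c]
  have \<phi>': "Ck_map A (Suc 0) \<phi>" using \<phi> by simp
  note lin = linear_differential_tv[OF \<phi>' c(1) p]
  have "inverse_metric A h ?p (w ?p) (differential A \<phi> ?p) = differential A \<phi> ?p (tv c ?p ?\<xi>)"
    unfolding sharp_coord_def sharp_solves(2)[OF h c(1) p C1_formD(1)[OF w c(1) p], symmetric]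
    by (rule inverse_metric_eq[OF h c(1) p C1_formD(1)[OF w c(1) p] lin])
  also have "\<dots> = (\<Sum>i\<in>UNIV. ?\<xi> $ i * differential A \<phi> ?p (tv c ?p (axis i 1)))"
    by (rule linear_axis_expansion[OF lin])
  finally show ?thesis .
qed

lemma continuous_inverse_metric_differential:
  assumes "C1_metric h" "C1_form w" "Ck_map A 1 \<phi>"
  shows "continuous_on UNIV (\<lambda>p. inverse_metric A h p (w p) (differential A \<phi> p))"
proof (rule continuous_on_UNIV_charts[of 0])
  fix c assume c: "c \<in> A"
  have \<phi>: "Ck_map A (Suc 0) \<phi>" using assms(3) by simp
  have 1: "Ck_on 0 (\<lambda>x. sharp_coord h w c x $ i) (chart_image c)" for i
    using Ck_on_le[OF Ck_on_sharp_coord[OF assms(1) c assms(2)], of 0] by simp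
  have "Ck_on 0 (\<lambda>x. \<Sum>i\<in>UNIV. sharp_coord h w c x $ i *
      differential A \<phi> (chart_inv c x) (tv c (chart_inv c x) (axis i 1))) (chart_image c)"
    by (intro Ck_on_sum Ck_on_mult open_chart_image[OF c] 1 Ck_on_differential[OF \<phi> c])
  then show "Ck_on 0 (\<lambda>x. inverse_metric A h (chart_inv c x) (w (chart_inv c x))
      (differential A \<phi> (chart_inv c x))) (chart_image c)"
    by (rule Ck_on_cong[OF open_chart_image[OF c], rotated])
      (rule inverse_metric_differential_coord[OF assms c, symmetric])
qed

text \<open>Inside one chart the codifferential of \<open>\<rho> w\<close> is the negative divergence
  \<open>- (\<Sum>\<^sub>i \<partial>\<^sub>i (\<rho> \<sigma> \<xi>\<^sub>i)) / \<sigma>\<close>, where \<open>\<xi>\<close> are the coordinates of the vector field dual to \<open>w\<close> and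
  \<open>\<sigma>\<close> is the volume density. The two sides of the duality differ by
  \<open>\<Sum>\<^sub>i \<integral> \<partial>\<^sub>i (\<rho> \<sigma> \<xi>\<^sub>i \<phi>)\<close>, an integral of derivatives of compactly supported functions.\<close>

lemma local_codifferential:
  assumes h: "C1_metric h" and w: "C1_form w" and \<rho>: "Ck_map A 1 \<rho>"
    and c: "c \<in> A" and K: "compact K" "K \<subseteq> fst c" "\<And>q. q \<notin> K \<Longrightarrow> \<rho> q = 0"
  shows "\<exists>d. continuous_on UNIV d \<and> (\<forall>\<phi>. Ck_map A 1 \<phi> \<longrightarrow>
    (\<integral>p. \<rho> p * inverse_metric A h p (w p) (differential A \<phi> p) \<partial>volume_measure A h) =
    (\<integral>p. d p * \<phi> p \<partial>volume_measure A h))"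
proof -
  let ?V = "chart_image c" and ?\<iota> = "chart_inv c" and ?\<sigma> = "vol_density h c" and ?\<xi> = "sharp_coord h w c"
  let ?L = "snd c ` K"
  have V: "open ?V" by (rule open_chart_image[OF c])
  have L: "compact ?L" "?L \<subseteq> ?V"
    using K(1,2) continuous_on_subset[OF continuous_on_chart[OF c]] by (auto intro: compact_continuous_image)
  have nL: "open (- ?L)" using compact_imp_closed[OF L(1)] by auto
  have VL: "?V \<union> - ?L = UNIV" using L(2) by blast
  have offL: "?\<iota> x \<notin> K" if "x \<in> ?V" "x \<notin> ?L" for x
    using that chart_chart_inv[OF c that(1)] by (metis imageI)
  \<comment> \<open>Extension by zero from the chart image preserves \<open>C\<^sup>1\<close> because all fields vanish there off
    a compact set.\<close>
  have extend: "Ck_on 1 (\<lambda>x. if x \<in> ?V then y x else 0) UNIV"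
    if y: "Ck_on 1 y ?V" "\<And>x. x \<in> ?V \<Longrightarrow> x \<notin> ?L \<Longrightarrow> y x = 0" for y :: "(real, 'm) vec \<Rightarrow> real"
  proof -
    have "Ck_on 1 (\<lambda>x. if x \<in> ?V then y x else 0) ?V"
      by (rule Ck_on_cong[OF V _ y(1)]) simp
    moreover have "Ck_on 1 (\<lambda>x. if x \<in> ?V then y x else 0) (- ?L)"
      by (rule Ck_on_cong[OF nL _ Ck_on_const[of 1 0]]) (use y(2) in auto)
    ultimately have "Ck_on 1 (\<lambda>x. if x \<in> ?V then y x else 0) (?V \<union> - ?L)" by (rule Ck_on_Un[OF V nL])
    then show ?thesis unfolding VL .
  qed
  define Y where "Y i x = (if x \<in> ?V then \<rho> (?\<iota> x) * ?\<sigma> x * ?\<xi> x $ i else 0)" for i x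
  have \<rho>1: "Ck_on 1 (\<lambda>x. \<rho> (?\<iota> x)) ?V" using \<rho> c by (auto simp: Ck_map_def o_def)
  have \<sigma>1: "Ck_on 1 ?\<sigma> ?V" by (rule Ck_on_vol_density[OF h c])
  have \<sigma>pos: "?\<sigma> x > 0" if "x \<in> ?V" for x using vol_density_pos[OF h c that] .
  have Y1: "Ck_on 1 (Y i) UNIV" for i
    unfolding Y_def using K(3) offL
    by (intro extend Ck_on_mult V \<rho>1 \<sigma>1 Ck_on_sharp_coord h c w) simp_all
  have Y0: "Y i x = 0" if "x \<notin> ?L" for i x
    using that offL[of x] K(3) by (auto simp: Y_def)
  let ?D = "\<lambda>x. \<Sum>i\<in>UNIV. frechet_derivative (Y i) (at x) (axis i 1)"
  have contD: "continuous_on UNIV ?D" using Y1 by (intro continuous_on_sum) simp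
  have D0: "?D x = 0" if "x \<notin> ?L" for x
    using frechet_derivative_zero_off[OF compact_imp_closed[OF L(1)] Y0 that] by simp
  define d where "d p = (if p \<in> fst c then - ?D (snd c p) / ?\<sigma> (snd c p) else 0)" for p
  have d0: "d p = 0" if "p \<notin> K" for p
  proof (cases "p \<in> fst c")
    case True
    have "snd c p \<notin> ?L"
    proof
      assume L: "snd c p \<in> ?L"
      obtain q where "q \<in> K" "snd c p = snd c q" using L by blast
      then have "q \<in> K" "p = q"
        using K(2) chart_inv_chart[OF c, of q] chart_inv_chart[OF c True] by auto
      then show False using that by simp
    qed
    then show ?thesis using D0 by (simp add: d_def)
  qed (simp add: d_def)
  have contd: "continuous_on UNIV d"
  proof -
    have "continuous_on (fst c) (\<lambda>p. - ?D (snd c p) / ?\<sigma> (snd c p))"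
    proof (rule continuous_on_divide[OF continuous_on_minus])
      show "continuous_on (fst c) (\<lambda>p. ?D (snd c p))"
        by (rule continuous_on_compose2[OF contD continuous_on_chart[OF c]]) simp
      show "continuous_on (fst c) (\<lambda>p. ?\<sigma> (snd c p))"
        by (rule continuous_on_compose2[OF Ck_on_imp_continuous[OF \<sigma>1] continuous_on_chart[OF c]]) simp
      show "\<forall>p\<in>fst c. ?\<sigma> (snd c p) \<noteq> 0" using \<sigma>pos by (metis imageI less_irrefl)
    qed
    then have 1: "continuous_on (fst c) d" by (rule continuous_on_eq) (simp add: d_def)
    have 2: "continuous_on (- K) d" by (rule continuous_on_eq[of _ "\<lambda>_. 0"]) (simp_all add: d0)
    have "fst c \<union> - K = UNIV" using K(2) by blast
    then show ?thesis
      using continuous_on_open_Un[OF open_chart[OF c] _ 1 2] compact_imp_closed[OF K(1)] by auto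
  qed
  have "(\<integral>p. \<rho> p * inverse_metric A h p (w p) (differential A \<phi> p) \<partial>volume_measure A h) =
      (\<integral>p. d p * \<phi> p \<partial>volume_measure A h)" if \<phi>: "Ck_map A 1 \<phi>" for \<phi>
  proof -
    let ?P = "\<lambda>i x. differential A \<phi> (?\<iota> x) (tv c (?\<iota> x) (axis i 1))"
    let ?inv = "\<lambda>p. inverse_metric A h p (w p) (differential A \<phi> p)"
    have \<phi>': "Ck_map A (Suc 0) \<phi>" using \<phi> by simp
    have \<phi>1: "Ck_on 1 (\<lambda>x. \<phi> (?\<iota> x)) ?V" using \<phi> c by (auto simp: Ck_map_def o_def)
    define Z where "Z i x = (if x \<in> ?V then Y i x * \<phi> (?\<iota> x) else 0)" for i x
    have Z1: "Ck_on 1 (Z i) UNIV" for i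
      unfolding Z_def using Y0 Ck_on_subset[OF Y1, of ?V] by (intro extend Ck_on_mult V \<phi>1) auto
    have Z0: "Z i x = 0" if "x \<notin> ?L" for i x using Y0[OF that] by (simp add: Z_def)
    let ?DZ = "\<lambda>i x. frechet_derivative (Z i) (at x) (axis i 1)"
    have DZ0: "?DZ i x = 0" if "x \<notin> ?L" for i x
      using frechet_derivative_zero_off[OF compact_imp_closed[OF L(1)] Z0 that] .
    have DZ: "?DZ i x = Y i x * ?P i x + frechet_derivative (Y i) (at x) (axis i 1) * \<phi> (?\<iota> x)"
      if x: "x \<in> ?V" for i x
    proof -
      have "(Y i has_derivative frechet_derivative (Y i) (at x)) (at x)"
        using Ck_on_has_derivative[of 0 "Y i" UNIV] Y1 by simp
      moreover have "((\<lambda>x. \<phi> (?\<iota> x)) has_derivative (\<lambda>\<xi>. differential A \<phi> (?\<iota> x) (tv c (?\<iota> x) \<xi>))) (at x)"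
        using differential_tv_has_derivative[OF \<phi>' c chart_inv_in[OF c x]] chart_chart_inv[OF c x]
        by (simp add: o_def)
      ultimately have "((\<lambda>x. Y i x * \<phi> (?\<iota> x)) has_derivative (\<lambda>\<xi>. Y i x * differential A \<phi> (?\<iota> x) (tv c (?\<iota> x) \<xi>) +
          frechet_derivative (Y i) (at x) \<xi> * \<phi> (?\<iota> x))) (at x)"
        by (rule has_derivative_mult)
      then have "(Z i has_derivative (\<lambda>\<xi>. Y i x * differential A \<phi> (?\<iota> x) (tv c (?\<iota> x) \<xi>) +
          frechet_derivative (Y i) (at x) \<xi> * \<phi> (?\<iota> x))) (at x)"
        by (rule has_derivative_transform_within_open[OF _ V x]) (simp add: Z_def)
      from fun_cong[OF frechet_derivative_at[OF this], of "axis i 1"] show ?thesis by simp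
    qed
    have intDZ: "integrable lborel (?DZ i)" for i
      by (rule integrable_lborel_compact_support[OF L(1) _ DZ0]) (use Z1[of i] in simp)
    let ?w = "\<lambda>x. indicator ?V x * ?\<sigma> x"
    have pointwise: "?w x * (\<rho> (?\<iota> x) * ?inv (?\<iota> x)) = ?w x * (d (?\<iota> x) * \<phi> (?\<iota> x)) + (\<Sum>i\<in>UNIV. ?DZ i x)" for x
    proof (cases "x \<in> ?V")
      case False
      then have "x \<notin> ?L" using L(2) by blast
      then show ?thesis using False DZ0 by simp
    next
      case True
      have "?\<sigma> x * (\<rho> (?\<iota> x) * ?inv (?\<iota> x)) = (\<Sum>i\<in>UNIV. Y i x * ?P i x)"
        unfolding inverse_metric_differential_coord[OF h w \<phi> c True]
        using True by (simp add: Y_def sum_distrib_left mult_ac)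
      moreover have "?\<sigma> x * d (?\<iota> x) = - ?D x"
        using True chart_inv_in[OF c True] chart_chart_inv[OF c True] \<sigma>pos[OF True] by (simp add: d_def)
      then have "?\<sigma> x * (d (?\<iota> x) * \<phi> (?\<iota> x)) = - ?D x * \<phi> (?\<iota> x)" by (simp add: mult.assoc[symmetric])
      moreover have "(\<Sum>i\<in>UNIV. ?DZ i x) = (\<Sum>i\<in>UNIV. Y i x * ?P i x) + ?D x * \<phi> (?\<iota> x)"
        by (simp add: DZ[OF True] sum.distrib sum_distrib_right)
      ultimately show ?thesis using True by simp
    qed
    have cont: "continuous_on UNIV (\<lambda>p. \<rho> p * ?inv p)" "continuous_on UNIV (\<lambda>p. d p * \<phi> p)"
      using Ck_map_imp_continuous[OF \<rho>] Ck_map_imp_continuous[OF \<phi>] contd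
        continuous_inverse_metric_differential[OF h w \<phi>] by (auto intro: continuous_intros)
    have supp: "\<rho> p * ?inv p = 0" "d p * \<phi> p = 0" if "p \<notin> fst c" for p
      using K(2,3) d0 that by auto
    note meas = borel_measurable_continuous_onI[OF cont(1)] borel_measurable_continuous_onI[OF cont(2)]
    have int: "integrable lborel (\<lambda>x. ?w x * (d (?\<iota> x) * \<phi> (?\<iota> x)))"
      using integrable_volume_continuous[OF h cont(2)] integrable_volume_chart[OF h c meas(2) supp(2)] by simp
    have "(\<integral>p. \<rho> p * ?inv p \<partial>volume_measure A h) = (\<integral>x. ?w x * (\<rho> (?\<iota> x) * ?inv (?\<iota> x)) \<partial>lborel)"
      using integral_volume_chart[OF h c meas(1) supp(1)] .
    also have "\<dots> = (\<integral>x. ?w x * (d (?\<iota> x) * \<phi> (?\<iota> x)) + (\<Sum>i\<in>UNIV. ?DZ i x) \<partial>lborel)"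
      unfolding pointwise ..
    also have "\<dots> = (\<integral>x. ?w x * (d (?\<iota> x) * \<phi> (?\<iota> x)) \<partial>lborel) + (\<Sum>i\<in>UNIV. \<integral>x. ?DZ i x \<partial>lborel)"
      using int intDZ by simp
    also have "(\<Sum>i\<in>UNIV. \<integral>x. ?DZ i x \<partial>lborel) = 0"
      using integral_derivative_zero[OF Z1 L(1) Z0] by simp
    also have "(\<integral>x. ?w x * (d (?\<iota> x) * \<phi> (?\<iota> x)) \<partial>lborel) + 0 = (\<integral>p. d p * \<phi> p \<partial>volume_measure A h)"
      using integral_volume_chart[OF h c meas(2) supp(2)] by simp
    finally show ?thesis .
  qed
  then show ?thesis using contd by blast
qed

lemma codifferential_exists:
  assumes h: "C1_metric h" and w: "C1_form w"
  shows "\<exists>d. continuous_on UNIV d \<and> (\<forall>\<phi>. Ck_map A 1 \<phi> \<longrightarrow>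
    (\<integral>p. inverse_metric A h p (w p) (differential A \<phi> p) \<partial>volume_measure A h) =
    (\<integral>p. d p * \<phi> p \<partial>volume_measure A h))"
proof -
  let ?\<mu> = "volume_measure A h" and ?inv = "\<lambda>\<phi> p. inverse_metric A h p (w p) (differential A \<phi> p)"
  obtain I :: "'a set" and \<rho> :: "'a \<Rightarrow> 'a \<Rightarrow> real" and c K where I: "finite I"
    and \<rho>: "\<forall>i\<in>I. Ck_map A 1 (\<rho> i) \<and> c i \<in> A \<and> compact (K i) \<and> K i \<subseteq> fst (c i) \<and> (\<forall>q. q \<notin> K i \<longrightarrow> \<rho> i q = 0)"
    and sum1: "\<forall>q. (\<Sum>i\<in>I. \<rho> i q) = 1"
    by (rule C1_partition_of_unity)
  have "\<forall>i\<in>I. \<exists>d. continuous_on UNIV d \<and> (\<forall>\<phi>. Ck_map A 1 \<phi> \<longrightarrow>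
      (\<integral>p. \<rho> i p * ?inv \<phi> p \<partial>?\<mu>) = (\<integral>p. d p * \<phi> p \<partial>?\<mu>))"
  proof
    fix i assume "i \<in> I"
    with \<rho> have "Ck_map A 1 (\<rho> i)" "c i \<in> A" "compact (K i)" "K i \<subseteq> fst (c i)" "\<And>q. q \<notin> K i \<Longrightarrow> \<rho> i q = 0"
      by auto
    then show "\<exists>d. continuous_on UNIV d \<and> (\<forall>\<phi>. Ck_map A 1 \<phi> \<longrightarrow>
      (\<integral>p. \<rho> i p * ?inv \<phi> p \<partial>?\<mu>) = (\<integral>p. d p * \<phi> p \<partial>?\<mu>))"
      by (rule local_codifferential[OF h w])
  qed
  then obtain d where d: "\<And>i. i \<in> I \<Longrightarrow> continuous_on UNIV (d i)"
    "\<And>i \<phi>. i \<in> I \<Longrightarrow> Ck_map A 1 \<phi> \<Longrightarrow> (\<integral>p. \<rho> i p * ?inv \<phi> p \<partial>?\<mu>) = (\<integral>p. d i p * \<phi> p \<partial>?\<mu>)"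
    using bchoice[of I "\<lambda>i d. continuous_on UNIV d \<and> (\<forall>\<phi>. Ck_map A 1 \<phi> \<longrightarrow>
      (\<integral>p. \<rho> i p * ?inv \<phi> p \<partial>?\<mu>) = (\<integral>p. d p * \<phi> p \<partial>?\<mu>))"] by blast
  have "(\<integral>p. ?inv \<phi> p \<partial>?\<mu>) = (\<integral>p. (\<Sum>i\<in>I. d i p) * \<phi> p \<partial>?\<mu>)" if \<phi>: "Ck_map A 1 \<phi>" for \<phi>
  proof -
    have "(\<integral>p. ?inv \<phi> p \<partial>?\<mu>) = (\<integral>p. (\<Sum>i\<in>I. \<rho> i p * ?inv \<phi> p) \<partial>?\<mu>)"
      using sum1 by (simp flip: sum_distrib_right)
    also have "\<dots> = (\<Sum>i\<in>I. \<integral>p. \<rho> i p * ?inv \<phi> p \<partial>?\<mu>)"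
      using \<rho> continuous_inverse_metric_differential[OF h w \<phi>]
      by (intro Bochner_Integration.integral_sum integrable_volume_continuous[OF h] continuous_on_mult)
        (auto intro: Ck_map_imp_continuous)
    also have "\<dots> = (\<Sum>i\<in>I. \<integral>p. d i p * \<phi> p \<partial>?\<mu>)" using d(2) \<phi> by simp
    also have "\<dots> = (\<integral>p. (\<Sum>i\<in>I. d i p * \<phi> p) \<partial>?\<mu>)"
      using d(1) Ck_map_imp_continuous[OF \<phi>]
      by (intro Bochner_Integration.integral_sum[symmetric] integrable_volume_continuous[OF h] continuous_on_mult)
    finally show ?thesis by (simp add: sum_distrib_right)
  qed
  moreover have "continuous_on UNIV (\<lambda>p. \<Sum>i\<in>I. d i p)" using d(1) by (intro continuous_on_sum)
  ultimately show ?thesis by blast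
qed

lemma smooth_imp_C1: "smooth_map A \<phi> \<Longrightarrow> Ck_map A 1 \<phi>"
  unfolding smooth_map_def by blast

text \<open>If the inequality failed at a point, a bump supported where it fails would give a nonnegative
  function with vanishing integral that is positive on an open set.\<close>

lemma smooth_test_functions_separate:
  fixes d d' :: "'a \<Rightarrow> real"
  assumes h: "C1_metric h" and d: "continuous_on UNIV d" "continuous_on UNIV d'"
    and eq: "\<And>\<phi>. smooth_map A \<phi> \<Longrightarrow>
      (\<integral>p. d p * \<phi> p \<partial>volume_measure A h) = (\<integral>p. d' p * \<phi> p \<partial>volume_measure A h)"
  shows "d p \<le> d' p"
proof (rule ccontr)
  assume "\<not> d p \<le> d' p"
  then have p: "p \<in> {q. d' q < d q}" by simp
  have "open {q. d' q < d q}" using d by (intro open_Collect_less)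
  then obtain \<phi> :: "'a \<Rightarrow> real" and c K where \<phi>: "smooth_map A \<phi>" "\<forall>q. 0 \<le> \<phi> q" "0 < \<phi> p"
    and c: "c \<in> A" and K: "compact K" "K \<subseteq> {q. d' q < d q} \<inter> fst c" "\<forall>q. q \<notin> K \<longrightarrow> \<phi> q = 0"
    by (rule smooth_bump[OF _ p])
  let ?\<theta> = "\<lambda>q. (d q - d' q) * \<phi> q" and ?\<mu> = "volume_measure A h"
  have \<phi>c: "continuous_on UNIV \<phi>" by (rule Ck_map_imp_continuous[OF smooth_imp_C1[OF \<phi>(1)]])
  have \<theta>c: "continuous_on UNIV ?\<theta>" using d \<phi>c by (intro continuous_intros)
  have \<theta>0: "0 \<le> ?\<theta> q" for q
    using K(2,3) \<phi>(2) by (cases "q \<in> K") auto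
  have supp: "?\<theta> q = 0" if "q \<notin> fst c" for q using that K by auto
  have "(\<integral>q. ?\<theta> q \<partial>?\<mu>) = (\<integral>q. d q * \<phi> q \<partial>?\<mu>) - (\<integral>q. d' q * \<phi> q \<partial>?\<mu>)"
    unfolding left_diff_distrib using d \<phi>c
    by (intro Bochner_Integration.integral_diff integrable_volume_continuous[OF h] continuous_intros)
  then have z: "(\<integral>q. ?\<theta> q \<partial>?\<mu>) = 0" using eq[OF \<phi>(1)] by simp
  let ?G = "\<lambda>x. indicator (chart_image c) x * vol_density h c x * ?\<theta> (chart_inv c x)"
  note meas = borel_measurable_continuous_onI[OF \<theta>c]
  have "integrable lborel ?G"
    using integrable_volume_chart[OF h c meas supp] integrable_volume_continuous[OF h \<theta>c] by simp
  moreover have "(\<integral>x. ?G x \<partial>lborel) = 0"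
    using integral_volume_chart[OF h c meas supp] z by simp
  moreover have "0 \<le> ?G x" for x
    using vol_density_nonneg[OF h c, of x] \<theta>0 by (rule mult_nonneg_nonneg)
  ultimately have AE: "AE x in lborel. ?G x = 0"
    using integral_nonneg_eq_0_iff_AE[of lborel ?G] by simp
  have pK: "p \<in> K" using K(3) \<phi>(3) less_irrefl by metis
  let ?O = "snd c ` (fst c \<inter> {q. 0 < ?\<theta> q})"
  have "open ?O" using \<theta>c by (intro open_chart_image_of[OF c] open_Collect_less continuous_on_const)
  moreover have "snd c p \<in> ?O" using pK K(2) \<phi>(3) p by auto
  ultimately obtain r where r: "r > 0" "ball (snd c p) r \<subseteq> ?O" by (meson open_contains_ball)
  have G: "?G x \<noteq> 0" if "x \<in> ?O" for x
  proof -
    obtain q where q: "q \<in> fst c" "0 < ?\<theta> q" "x = snd c q" using \<open>x \<in> ?O\<close> by blast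
    then have "?G x = vol_density h c x * ?\<theta> q" using chart_inv_chart[OF c q(1)] by simp
    moreover have "vol_density h c x > 0" using vol_density_pos[OF h c] q by blast
    ultimately show ?thesis using mult_pos_pos q(2) less_irrefl by metis
  qed
  have "AE x in lborel. x \<notin> ball (snd c p) r"
    using AE
  proof (rule eventually_mono)
    fix x assume "?G x = 0"
    then show "x \<notin> ball (snd c p) r" using G r(2) by blast
  qed
  then have "emeasure lborel (ball (snd c p) r) = 0"
    using AE_iff_null_sets[of "ball (snd c p) r" lborel] by (simp add: null_sets_def)
  then show False using content_ball_pos[OF r(1), of "snd c p"] by (simp add: measure_def)
qed

lemma codifferential:
  assumes h: "C1_metric h" and w: "C1_form w"
  shows "continuous_on UNIV (codifferential A h w)"
    and "Ck_map A 1 \<phi> \<Longrightarrow>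
      (\<integral>p. inverse_metric A h p (w p) (differential A \<phi> p) \<partial>volume_measure A h) =
      (\<integral>p. codifferential A h w p * \<phi> p \<partial>volume_measure A h)"
proof -
  obtain d where d: "continuous_on UNIV d" "\<And>\<phi>. Ck_map A 1 \<phi> \<Longrightarrow>
    (\<integral>p. inverse_metric A h p (w p) (differential A \<phi> p) \<partial>volume_measure A h) =
    (\<integral>p. d p * \<phi> p \<partial>volume_measure A h)"
    using codifferential_exists[OF h w] by blast
  have "codifferential A h w = d"
    unfolding codifferential_def
  proof (rule the_equality)
    fix d' assume d': "continuous_on UNIV d' \<and> (\<forall>f. smooth_map A f \<longrightarrow>
        (\<integral>p. inverse_metric A h p (w p) (differential A f p) \<partial>volume_measure A h) =
        (\<integral>p. d' p * f p \<partial>volume_measure A h))"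
    then have eq: "(\<integral>p. d p * \<phi> p \<partial>volume_measure A h) = (\<integral>p. d' p * \<phi> p \<partial>volume_measure A h)"
      if "smooth_map A \<phi>" for \<phi> using d(2)[OF smooth_imp_C1[OF that]] that by simp
    have "d p \<le> d' p" "d' p \<le> d p" for p
      using smooth_test_functions_separate[OF h, of d d'] smooth_test_functions_separate[OF h, of d' d] d d' eq by auto
    then show "d' = d" by (simp add: fun_eq_iff order.eq_iff)
  qed (use d smooth_imp_C1 in auto)
  then show "continuous_on UNIV (codifferential A h w)"
    and "Ck_map A 1 \<phi> \<Longrightarrow>
      (\<integral>p. inverse_metric A h p (w p) (differential A \<phi> p) \<partial>volume_measure A h) =
      (\<integral>p. codifferential A h w p * \<phi> p \<partial>volume_measure A h)"
    using d by auto
qed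

text \<open>The test function here is \<open>f\<close> itself, which need not be smooth; therefore the duality is needed
  for \<open>C\<^sup>1\<close> test functions.\<close>

lemma dirichlet_form_eq:
  assumes h: "C1_metric h" and f: "Ck_map A 2 f"
  shows "dirichlet_form A h f =
    (\<integral>p. inverse_metric A h p (differential A f p) (differential A f p) \<partial>volume_measure A h)"
  using codifferential(2)[OF h C1_form_differential[OF f] Ck_map_le[OF f, of 1]]
  by (simp add: dirichlet_form_def laplacian_def mult.commute)

end

section \<open>The metric of cone kernels\<close>

lemma Ck_on_matrix_form:
  fixes M :: "'v::real_normed_vector \<Rightarrow> real^'n^'n"
  assumes "open S" "\<And>i j. Ck_on k (\<lambda>x. M x $ i $ j) S" "Ck_on k \<xi> S" "Ck_on k \<eta> S"
  shows "Ck_on k (\<lambda>x. \<xi> x \<bullet> (M x *v \<eta> x)) S"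
  unfolding inner_vec_def matrix_vector_mult_def
  by (simp, intro Ck_on_sum Ck_on_mult Ck_on_vec_nth assms)

text \<open>The rank-one correction factors as \<open>M (I - b u (M u)\<^sup>T)\<close>, so the matrix determinant lemma
  applies. In the cone metric \<open>u\<close> is \<open>v\<close> and \<open>b u\<^sup>T M u = \<zeta>\<close>.\<close>

lemma det_cone_matrix:
  fixes M :: "real^'n^'n" and u :: "real^'n"
  shows "det (\<chi> i j. a * (M $ i $ j - b * ((M *v u) $ i * (M *v u) $ j))) =
    a ^ CARD('n) * (1 - b * (u \<bullet> (M *v u))) * det M"
proof -
  let ?P = "(\<chi> i j. mat 1 $ i $ j + u $ i * (- b *\<^sub>R (M *v u)) $ j) :: real^'n^'n"
  have "(M ** ?P) $ i $ j = M $ i $ j - b * ((M *v u) $ i * (M *v u) $ j)" for i j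
  proof -
    have "(M ** ?P) $ i $ j = (\<Sum>k\<in>UNIV. M $ i $ k * mat 1 $ k $ j) +
        (\<Sum>k\<in>UNIV. M $ i $ k * u $ k) * (- b *\<^sub>R (M *v u)) $ j"
      by (simp add: matrix_matrix_mult_def sum_distrib_left sum_distrib_right sum.distrib algebra_simps
        sum_subtractf sum_negf)
    also have "(\<Sum>k\<in>UNIV. M $ i $ k * mat 1 $ k $ j) = (M ** mat 1) $ i $ j"
      by (simp only: matrix_matrix_mult_def vec_lambda_beta)
    also have "(\<Sum>k\<in>UNIV. M $ i $ k * u $ k) = (M *v u) $ i"
      by (simp only: matrix_vector_mult_def vec_lambda_beta)
    finally show ?thesis by simp
  qed
  then have "(\<chi> i j. a * (M $ i $ j - b * ((M *v u) $ i * (M *v u) $ j))) = (\<chi> i. a *s (M ** ?P) $ i)"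
    by (simp add: vec_eq_iff)
  then have "det (\<chi> i j. a * (M $ i $ j - b * ((M *v u) $ i * (M *v u) $ j))) =
      a ^ CARD('n) * det (\<chi> i. (M ** ?P) $ i)"
    by (simp only: det_rows_mul prod_constant)
  also have "(\<chi> i. (M ** ?P) $ i) = M ** ?P" by (simp add: vec_eq_iff)
  also have "det (M ** ?P) = det M * (1 + u \<bullet> (- b *\<^sub>R (M *v u)))"
    by (simp only: det_mul det_mat1_plus_rank1)
  finally show ?thesis by simp
qed

context compact_manifold
begin

lemma induced_metric_C1:
  fixes F :: "'a \<Rightarrow> 'b::euclidean_space"
  assumes ip: "is_inner_product ip" and F: "Ck_embedding A 2 F"
  shows "C1_metric (induced_metric A ip F)"
  unfolding C1_metric_def
proof (intro conjI ballI allI)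
  have F2: "Ck_map A (Suc 1) F" using F by (simp add: Ck_embedding_def numeral_2_eq_2)
  have bil: "bilinear ip" using ip by (simp add: is_inner_product_def)
  fix c assume c: "c \<in> A"
  {
    fix p assume p: "p \<in> fst c"
    let ?L = "\<lambda>\<xi>. differential A F p (tv c p \<xi>)"
    have lin: "linear ?L" by (rule linear_differential_tv[OF F2 c p])
    have "?L \<xi> \<noteq> 0" if "\<xi> \<noteq> 0" for \<xi>
    proof
      assume "?L \<xi> = 0"
      then have "?L \<xi> = ?L 0" using linear_0[OF lin] by simp
      then have "tv c p \<xi> = tv c p 0"
        using F inj_onD[of "differential A F p" "tangent_space A p"] tv_in_tangent_space[OF c p]
        unfolding Ck_embedding_def by blast
      then show False using that tv_nth[OF c p] by metis
    qed
    moreover have "bilinear (\<lambda>\<xi> \<eta>. ip (?L \<xi>) (?L \<eta>))"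
      using bil linear_compose[OF lin] unfolding bilinear_def o_def by blast
    ultimately show "is_inner_product (\<lambda>\<xi> \<eta>. induced_metric A ip F p (tv c p \<xi>) (tv c p \<eta>))"
      using ip by (simp add: is_inner_product_def induced_metric_def)
  }
  show "Ck_on 1 (\<lambda>x. metric_matrix A (induced_metric A ip F) c (chart_inv c x) $ i $ j) (chart_image c)" for i j
    unfolding metric_matrix_eq_gram gram_def induced_metric_def vec_lambda_beta
    using bil unfolding bilinear_conv_bounded_bilinear
    by (rule Ck_on_bilinear[OF _ open_chart_image[OF c] Ck_on_differential[OF F2 c] Ck_on_differential[OF F2 c]])
qed

lemma metric_eq_matrix_form:
  assumes "C1_metric h" "c \<in> A" "p \<in> fst c"
  shows "h p (tv c p \<xi>) (tv c p \<eta>) = \<xi> \<bullet> (metric_matrix A h c p *v \<eta>)"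
  unfolding metric_matrix_eq_gram
  using bilinear_eq_gram[OF is_inner_productD(1)[OF C1_metricD(1)[OF assms]]] .

text \<open>A relation between two volume densities that holds in every chart passes to integrals over the
  manifold by localising with a partition of unity.\<close>

lemma integral_volume_rescaled:
  assumes h: "C1_metric h" and g: "C1_metric g"
    and w: "continuous_on UNIV w" and \<theta>: "continuous_on UNIV \<theta>"
    and dens: "\<And>c x. c \<in> A \<Longrightarrow> x \<in> chart_image c \<Longrightarrow> vol_density h c x = w (chart_inv c x) * vol_density g c x"
  shows "(\<integral>p. \<theta> p \<partial>volume_measure A h) = (\<integral>p. w p * \<theta> p \<partial>volume_measure A g)"
proof -
  obtain I :: "'a set" and \<rho> :: "'a \<Rightarrow> 'a \<Rightarrow> real" and c K where I: "finite I"
    and \<rho>: "\<forall>i\<in>I. Ck_map A 1 (\<rho> i) \<and> c i \<in> A \<and> compact (K i) \<and> K i \<subseteq> fst (c i) \<and> (\<forall>q. q \<notin> K i \<longrightarrow> \<rho> i q = 0)"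
    and sum1: "\<forall>q. (\<Sum>i\<in>I. \<rho> i q) = 1"
    by (rule C1_partition_of_unity)
  have split: "(\<integral>p. \<psi> p \<partial>volume_measure A m) = (\<Sum>i\<in>I. \<integral>p. \<rho> i p * \<psi> p \<partial>volume_measure A m)"
    if "C1_metric m" "continuous_on UNIV \<psi>" for m and \<psi> :: "'a \<Rightarrow> real"
  proof -
    have "(\<integral>p. \<psi> p \<partial>volume_measure A m) = (\<integral>p. (\<Sum>i\<in>I. \<rho> i p * \<psi> p) \<partial>volume_measure A m)"
      using sum1 by (simp flip: sum_distrib_right)
    also have "\<dots> = (\<Sum>i\<in>I. \<integral>p. \<rho> i p * \<psi> p \<partial>volume_measure A m)"
      using \<rho> that
      by (intro Bochner_Integration.integral_sum integrable_volume_continuous continuous_on_mult)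
        (auto intro: Ck_map_imp_continuous)
    finally show ?thesis .
  qed
  have w\<theta>: "continuous_on UNIV (\<lambda>p. w p * \<theta> p)" using w \<theta> by (rule continuous_on_mult)
  have "(\<integral>p. \<rho> i p * \<theta> p \<partial>volume_measure A h) = (\<integral>p. \<rho> i p * (w p * \<theta> p) \<partial>volume_measure A g)"
    if i: "i \<in> I" for i
  proof -
    have ci: "c i \<in> A" and \<rho>c: "continuous_on UNIV (\<rho> i)" and supp: "\<And>q. q \<notin> fst (c i) \<Longrightarrow> \<rho> i q = 0"
      using \<rho> i Ck_map_imp_continuous by blast+
    have "(\<integral>p. \<rho> i p * \<theta> p \<partial>volume_measure A h) = (\<integral>x. indicator (chart_image (c i)) x * vol_density h (c i) x *
        (\<rho> i (chart_inv (c i) x) * \<theta> (chart_inv (c i) x)) \<partial>lborel)"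
      using \<rho>c \<theta> supp
      by (intro integral_volume_chart[OF h ci] borel_measurable_continuous_onI continuous_on_mult) auto
    also have "\<dots> = (\<integral>x. indicator (chart_image (c i)) x * vol_density g (c i) x *
        (\<rho> i (chart_inv (c i) x) * (w (chart_inv (c i) x) * \<theta> (chart_inv (c i) x))) \<partial>lborel)"
      by (rule Bochner_Integration.integral_cong[OF refl]) (simp add: dens[OF ci] split: split_indicator)
    also have "\<dots> = (\<integral>p. \<rho> i p * (w p * \<theta> p) \<partial>volume_measure A g)"
      using \<rho>c w \<theta> supp
      by (intro integral_volume_chart[OF g ci, symmetric] borel_measurable_continuous_onI continuous_on_mult) auto
    finally show ?thesis .
  qed
  then show ?thesis using split[OF h \<theta>] split[OF g w\<theta>] by simp
qed

end

locale cone_kernel_setting = compact_manifold A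
  for A :: "('a::{t2_space,second_countable_topology}, 'm::{finite,wellorder}) chart set" +
  fixes g :: "('a, 'm) metric" and v :: "'a \<Rightarrow> ('a, 'm) tvec"
  assumes g: "C1_metric g" and v: "Ck_vector_field A 1 v" and v_nonzero: "\<And>p. v p \<noteq> (\<lambda>_. 0)"
begin

abbreviation speed :: "'a \<Rightarrow> real" where
  "speed \<equiv> metric_norm g v"

lemma v_coord: "c \<in> A \<Longrightarrow> p \<in> fst c \<Longrightarrow> v p = tv c p (v p c)"
  using tangent_space_eq_tv v unfolding Ck_vector_field_def by blast

lemma Ck_on_v_coord: "c \<in> A \<Longrightarrow> Ck_on 1 (\<lambda>x. v (chart_inv c x) c) (chart_image c)"
  using v unfolding Ck_vector_field_def by blast

lemma v_coord_nonzero: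
  assumes "c \<in> A" "p \<in> fst c"
  shows "v p c \<noteq> 0"
proof
  assume z: "v p c = 0"
  have "v p = (\<lambda>_. 0)"
  proof
    fix c'
    have "v p c' = tv c p 0 c'" using v_coord[OF assms] z by metis
    then show "v p c' = 0"
      using linear_0[OF linear_transition_deriv[OF assms(1) _ assms(2)], of c'] by (simp add: tangent_of_def split: if_splits)
  qed
  then show False using v_nonzero by blast
qed

lemma g_v_v_pos: "g p (v p) (v p) > 0"
proof -
  obtain c where c: "c \<in> A" "p \<in> fst c" using chart_at .
  show ?thesis
    using is_inner_productD(3)[OF C1_metricD(1)[OF g c] v_coord_nonzero[OF c]] v_coord[OF c] by simp
qed

lemma speed_sq: "(speed p)\<^sup>2 = g p (v p) (v p)" and speed_pos: "speed p > 0"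
  using g_v_v_pos[of p] by (simp_all add: metric_norm_def)

lemma g_v_v_coord:
  assumes "c \<in> A" "x \<in> chart_image c"
  shows "(speed (chart_inv c x))\<^sup>2 =
    v (chart_inv c x) c \<bullet> (metric_matrix A g c (chart_inv c x) *v v (chart_inv c x) c)"
  using metric_eq_matrix_form[OF g assms(1) chart_inv_in[OF assms]] v_coord[OF assms(1) chart_inv_in[OF assms]] speed_sq by metis

lemma Ck_on_speed_sq:
  assumes c: "c \<in> A"
  shows "Ck_on 1 (\<lambda>x. (speed (chart_inv c x))\<^sup>2) (chart_image c)"
proof -
  have "Ck_on 1 (\<lambda>x. v (chart_inv c x) c \<bullet>
      (metric_matrix A g c (chart_inv c x) *v v (chart_inv c x) c)) (chart_image c)"
    by (rule Ck_on_matrix_form[OF open_chart_image[OF c] C1_metricD(2)[OF g c] Ck_on_v_coord[OF c] Ck_on_v_coord[OF c]])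
  then show ?thesis
    by (rule Ck_on_cong[OF open_chart_image[OF c], rotated]) (simp add: g_v_v_coord[OF c])
qed

lemma continuous_speed: "continuous_on UNIV speed"
proof -
  have "continuous_on UNIV (\<lambda>p. (speed p)\<^sup>2)" by (rule continuous_on_UNIV_charts[OF Ck_on_speed_sq])
  then have "continuous_on UNIV (\<lambda>p. sqrt ((speed p)\<^sup>2))" by (rule continuous_on_real_sqrt)
  then show ?thesis using speed_pos by (simp add: less_imp_le)
qed

lemma cone_metric_tv:
  assumes "c \<in> A" "p \<in> fst c"
  shows "cone_metric g v \<zeta> p (tv c p \<xi>) (tv c p \<eta>) = 1 / (speed p)\<^sup>2 * (g p (tv c p \<xi>) (tv c p \<eta>) -
    \<zeta> / (speed p)\<^sup>2 * (g p (v p) (tv c p \<xi>) * g p (v p) (tv c p \<eta>)))"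
  by (simp add: cone_metric_def dual_form_def)

lemma cone_matrix:
  assumes c: "c \<in> A" "p \<in> fst c"
  defines "M \<equiv> metric_matrix A g c p"
  shows "metric_matrix A (cone_metric g v \<zeta>) c p =
    (\<chi> i j. 1 / (speed p)\<^sup>2 * (M $ i $ j - \<zeta> / (speed p)\<^sup>2 * ((M *v v p c) $ i * (M *v v p c) $ j)))"
proof -
  have "g p (v p) (tv c p (axis i 1)) = (M *v v p c) $ i" for i
  proof -
    have "g p (v p) (tv c p (axis i 1)) = g p (tv c p (axis i 1)) (tv c p (v p c))"
      using is_inner_productD(2)[OF C1_metricD(1)[OF g c]] v_coord[OF c] by metis
    then show ?thesis unfolding metric_eq_matrix_form[OF g c] M_def by (simp add: inner_axis')
  qed
  then show ?thesis
    by (simp add: vec_eq_iff metric_matrix_def coord_vec_eq cone_metric_tv[OF c] M_def)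
qed

text \<open>Positivity uses the orthogonal decomposition \<open>\<xi> = \<xi>' + a v\<close>: the form is
  \<open>(g(\<xi>', \<xi>') + (1 - \<zeta>) a\<^sup>2 \<parallel>v\<parallel>\<^sup>2) / \<parallel>v\<parallel>\<^sup>2\<close>.\<close>

lemma cone_metric_C1:
  assumes \<zeta>: "\<zeta> < 1"
  shows "C1_metric (cone_metric g v \<zeta>)"
  unfolding C1_metric_def
proof (intro conjI ballI allI)
  fix c assume c: "c \<in> A"
  {
    fix p assume p: "p \<in> fst c"
    let ?B = "\<lambda>\<xi> \<eta>. g p (tv c p \<xi>) (tv c p \<eta>)" and ?u = "v p c"
    note ip = C1_metricD(1)[OF g c p]
    note bil = is_inner_productD(1)[OF ip] and sym = is_inner_productD(2)[OF ip]
    have eq: "cone_metric g v \<zeta> p (tv c p \<xi>) (tv c p \<eta>) =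
        1 / (speed p)\<^sup>2 * (?B \<xi> \<eta> - \<zeta> / (speed p)\<^sup>2 * (?B ?u \<xi> * ?B ?u \<eta>))" for \<xi> \<eta>
      using cone_metric_tv[OF c p] v_coord[OF c p] by simp
    have n2: "(speed p)\<^sup>2 = ?B ?u ?u" using speed_sq v_coord[OF c p] by simp
    have n0: "(speed p)\<^sup>2 > 0" using speed_pos[of p] by simp
    have bilc: "bilinear (\<lambda>\<xi> \<eta>. 1 / (speed p)\<^sup>2 * (?B \<xi> \<eta> - \<zeta> / (speed p)\<^sup>2 * (?B ?u \<xi> * ?B ?u \<eta>)))"
      unfolding bilinear_def
      by (auto intro!: linearI simp: bilinear_ladd[OF bil] bilinear_radd[OF bil] bilinear_lmul[OF bil]
          bilinear_rmul[OF bil] algebra_simps add_divide_distrib)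
    have "1 / (speed p)\<^sup>2 * (?B \<xi> \<xi> - \<zeta> / (speed p)\<^sup>2 * (?B ?u \<xi> * ?B ?u \<xi>)) > 0" if "\<xi> \<noteq> 0" for \<xi>
    proof -
      define a where "a = ?B ?u \<xi> / (speed p)\<^sup>2"
      define \<xi>' where "\<xi>' = \<xi> - a *\<^sub>R ?u"
      have Bu: "?B ?u \<xi> = a * (speed p)\<^sup>2" using n0 by (simp add: a_def)
      have "?B \<xi>' \<xi>' = ?B \<xi> \<xi> - a\<^sup>2 * (speed p)\<^sup>2"
        unfolding \<xi>'_def using Bu sym[of \<xi> ?u] n2
        by (simp add: bilinear_lsub[OF bil] bilinear_rsub[OF bil] bilinear_lmul[OF bil] bilinear_rmul[OF bil]
            algebra_simps power2_eq_square)
      then have "?B \<xi> \<xi> - \<zeta> / (speed p)\<^sup>2 * (?B ?u \<xi> * ?B ?u \<xi>) = ?B \<xi>' \<xi>' + (1 - \<zeta>) * a\<^sup>2 * (speed p)\<^sup>2"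
        using n0 unfolding Bu by (simp add: field_simps power2_eq_square)
      also have "\<dots> > 0"
      proof (cases "\<xi>' = 0")
        case True
        then have "a \<noteq> 0" using that by (auto simp: \<xi>'_def)
        then have "(1 - \<zeta>) * a\<^sup>2 * (speed p)\<^sup>2 > 0" using \<zeta> n0 by simp
        moreover have "?B \<xi>' \<xi>' = 0" using True bilinear_lzero[OF bil] by simp
        ultimately show ?thesis by simp
      next
        case False
        then have "?B \<xi>' \<xi>' > 0" by (rule is_inner_productD(3)[OF ip])
        moreover have "(1 - \<zeta>) * a\<^sup>2 * (speed p)\<^sup>2 \<ge> 0" using \<zeta> by simp
        ultimately show ?thesis by simp
      qed
      finally show ?thesis using n0 by simp
    qed
    then show "is_inner_product (\<lambda>\<xi> \<eta>. cone_metric g v \<zeta> p (tv c p \<xi>) (tv c p \<eta>))"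
      unfolding is_inner_product_def eq using bilc sym by (simp add: mult.commute)
  }
  fix i j
  let ?M = "\<lambda>x. metric_matrix A g c (chart_inv c x)" and ?u = "\<lambda>x. v (chart_inv c x) c"
    and ?n2 = "\<lambda>x. (speed (chart_inv c x))\<^sup>2"
  note V = open_chart_image[OF c]
  have M: "Ck_on 1 (\<lambda>x. ?M x $ i $ j) (chart_image c)" for i j by (rule C1_metricD(2)[OF g c])
  have Mu: "Ck_on 1 (\<lambda>x. (?M x *v ?u x) $ i) (chart_image c)" for i
    unfolding matrix_vector_mult_def vec_lambda_beta
    by (intro Ck_on_sum Ck_on_mult Ck_on_vec_nth V M Ck_on_v_coord[OF c])
  have n0: "?n2 x \<noteq> 0" for x using speed_pos[of "chart_inv c x"] by simp
  have "Ck_on 1 (\<lambda>x. 1 / ?n2 x * (?M x $ i $ j - \<zeta> / ?n2 x * ((?M x *v ?u x) $ i * (?M x *v ?u x) $ j))) (chart_image c)"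
    by (intro Ck_on_mult Ck_on_diff Ck_on_divide V Ck_on_const M Mu Ck_on_speed_sq[OF c] n0)
  then show "Ck_on 1 (\<lambda>x. metric_matrix A (cone_metric g v \<zeta>) c (chart_inv c x) $ i $ j) (chart_image c)"
    by (rule Ck_on_cong[OF V, rotated]) (simp add: cone_matrix[OF c chart_inv_in[OF c]])
qed

lemma vol_density_cone:
  assumes c: "c \<in> A" "x \<in> chart_image c"
  shows "vol_density (cone_metric g v \<zeta>) c x =
    sqrt (1 - \<zeta>) / speed (chart_inv c x) ^ CARD('m) * vol_density g c x"
proof -
  let ?p = "chart_inv c x"
  have "det (metric_matrix A (cone_metric g v \<zeta>) c ?p) =
      (1 / (speed ?p)\<^sup>2) ^ CARD('m) * (1 - \<zeta> / (speed ?p)\<^sup>2 * (speed ?p)\<^sup>2) * det (metric_matrix A g c ?p)"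
    unfolding cone_matrix[OF c(1) chart_inv_in[OF c]] det_cone_matrix g_v_v_coord[OF c] ..
  also have "\<dots> = (1 - \<zeta>) / (speed ?p ^ CARD('m))\<^sup>2 * det (metric_matrix A g c ?p)"
    using speed_pos[of ?p] by (simp add: power_divide power_mult[symmetric] mult.commute)
  finally show ?thesis
    unfolding vol_density_def using speed_pos[of ?p] by (simp add: real_sqrt_mult real_sqrt_divide)
qed

text \<open>The gradient for the cone metric is \<open>\<parallel>v\<parallel>\<^sup>2 (s + k v)\<close> with \<open>s\<close> the gradient for \<open>g\<close>. The
  coefficient \<open>k\<close> solves \<open>k = \<zeta> (v f + k \<parallel>v\<parallel>\<^sup>2) / \<parallel>v\<parallel>\<^sup>2\<close>, which makes the component along
  \<open>v\<close> come out right.\<close>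

lemma inverse_metric_cone:
  assumes \<zeta>: "\<zeta> < 1" and f: "Ck_map A 1 f"
  shows "inverse_metric A (cone_metric g v \<zeta>) p (differential A f p) (differential A f p) =
    (speed p)\<^sup>2 * inverse_metric A g p (differential A f p) (differential A f p) - (dir_deriv A v f p)\<^sup>2
    + (dir_deriv A v f p)\<^sup>2 / (1 - \<zeta>)"
proof -
  obtain c where c: "c \<in> A" "p \<in> fst c" using chart_at .
  let ?h = "cone_metric g v \<zeta>" and ?df = "differential A f p" and ?u = "v p c"
  let ?B = "\<lambda>\<xi> \<eta>. g p (tv c p \<xi>) (tv c p \<eta>)"
  note h = cone_metric_C1[OF \<zeta>]
  note ip = C1_metricD(1)[OF g c]
  note bil = is_inner_productD(1)[OF ip] and sym = is_inner_productD(2)[OF ip]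
  have f': "Ck_map A (Suc 0) f" using f by simp
  note lin = linear_differential_tv[OF f' c]
  obtain s where s: "sharp A g p ?df = tv c p s" using sharp_solves(2)[OF g c lin] by blast
  have Bs: "?B s \<eta> = ?df (tv c p \<eta>)" for \<eta> using sharp_solves(1)[OF g c lin] s by simp
  define a where "a = dir_deriv A v f p"
  have a: "a = ?df (tv c p ?u)" unfolding a_def dir_deriv_def using v_coord[OF c] by simp
  have n2: "(speed p)\<^sup>2 = ?B ?u ?u" using speed_sq v_coord[OF c] by simp
  have n0: "(speed p)\<^sup>2 > 0" using speed_pos[of p] by simp
  define k where "k = \<zeta> * a / ((speed p)\<^sup>2 * (1 - \<zeta>))"
  let ?s = "(speed p)\<^sup>2 *\<^sub>R (s + k *\<^sub>R ?u)"
  have "?h p (tv c p ?s) (tv c p \<eta>) = ?df (tv c p \<eta>)" for \<eta>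
  proof -
    have 1: "?B ?s \<eta> = (speed p)\<^sup>2 * (?df (tv c p \<eta>) + k * ?B ?u \<eta>)"
      by (simp add: bilinear_ladd[OF bil] bilinear_lmul[OF bil] Bs)
    have 2: "?B ?u ?s = (speed p)\<^sup>2 * (a + k * (speed p)\<^sup>2)"
      using sym[of ?u s] n2 by (simp add: bilinear_radd[OF bil] bilinear_rmul[OF bil] Bs a)
    have "k * (1 - \<zeta>) * (speed p)\<^sup>2 = \<zeta> * a" using n0 \<zeta> by (simp add: k_def)
    then have "k - \<zeta> / (speed p)\<^sup>2 * (a + k * (speed p)\<^sup>2) = 0" using n0 by (simp add: field_simps)
    moreover have "?h p (tv c p ?s) (tv c p \<eta>) =
        ?df (tv c p \<eta>) + (k - \<zeta> / (speed p)\<^sup>2 * (a + k * (speed p)\<^sup>2)) * ?B ?u \<eta>"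
    proof -
      have "?h p (tv c p ?s) (tv c p \<eta>) =
          1 / (speed p)\<^sup>2 * (?B ?s \<eta> - \<zeta> / (speed p)\<^sup>2 * (?B ?u ?s * ?B ?u \<eta>))"
        using cone_metric_tv[OF c] v_coord[OF c] by simp
      also have "\<dots> = ?df (tv c p \<eta>) + (k - \<zeta> / (speed p)\<^sup>2 * (a + k * (speed p)\<^sup>2)) * ?B ?u \<eta>"
        unfolding 1 2 using n0 speed_pos[of p] by (simp add: field_simps)
      finally show ?thesis .
    qed
    ultimately show ?thesis by simp
  qed
  then have "sharp A ?h p ?df = tv c p ?s" by (rule sharp_eqI[OF h c])
  then have "inverse_metric A ?h p ?df ?df = ?df (tv c p ?s)"
    using inverse_metric_eq[OF h c lin lin] by simp
  also have "\<dots> = (speed p)\<^sup>2 * (?df (tv c p s) + k * a)"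
    using linear_scale[OF lin] linear_add[OF lin] a by simp
  also have "?df (tv c p s) = inverse_metric A g p ?df ?df"
    using inverse_metric_eq[OF g c lin lin] s by simp
  also have "(speed p)\<^sup>2 * (inverse_metric A g p ?df ?df + k * a) =
      (speed p)\<^sup>2 * inverse_metric A g p ?df ?df - a\<^sup>2 + a\<^sup>2 / (1 - \<zeta>)"
  proof -
    have "(speed p)\<^sup>2 * (k * a) = \<zeta> * a\<^sup>2 / (1 - \<zeta>)" using n0 speed_pos[of p] by (simp add: k_def power2_eq_square)
    also have "\<dots> = a\<^sup>2 / (1 - \<zeta>) - a\<^sup>2" using \<zeta> by (simp add: field_simps)
    finally show ?thesis by (simp add: distrib_left)
  qed
  finally show ?thesis by (simp add: a_def)
qed

lemma continuous_dir_deriv: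
  assumes f: "Ck_map A 1 f"
  shows "continuous_on UNIV (dir_deriv A v f)"
proof (rule continuous_on_UNIV_charts[of 0])
  fix c assume c: "c \<in> A"
  have f': "Ck_map A (Suc 0) f" using f by simp
  have "Ck_on 0 (\<lambda>x. \<Sum>i\<in>UNIV. v (chart_inv c x) c $ i *
      differential A f (chart_inv c x) (tv c (chart_inv c x) (axis i 1))) (chart_image c)"
    by (intro Ck_on_sum Ck_on_mult Ck_on_vec_nth open_chart_image[OF c] Ck_on_differential[OF f' c]
        Ck_on_le[OF Ck_on_v_coord[OF c]]) simp
  then show "Ck_on 0 (\<lambda>x. dir_deriv A v f (chart_inv c x)) (chart_image c)"
  proof (rule Ck_on_cong[OF open_chart_image[OF c], rotated])
    fix x assume x: "x \<in> chart_image c"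
    show "(\<Sum>i\<in>UNIV. v (chart_inv c x) c $ i * differential A f (chart_inv c x) (tv c (chart_inv c x) (axis i 1))) =
        dir_deriv A v f (chart_inv c x)"
      using linear_axis_expansion[OF linear_differential_tv[OF f' c chart_inv_in[OF c x]], of "v (chart_inv c x) c"]
        v_coord[OF c chart_inv_in[OF c x]] by (simp add: dir_deriv_def)
  qed
qed

text \<open>The expansion without error term; the second integral does not involve \<open>\<zeta>\<close>.\<close>

theorem dirichlet_form_cone:
  assumes \<zeta>: "\<zeta> < 1" and f: "Ck_map A 2 f"
  shows "dirichlet_form A (cone_metric g v \<zeta>) f =
    limit_dirichlet_form A g v f / sqrt (1 - \<zeta>) +
    sqrt (1 - \<zeta>) * (\<integral>p. 1 / speed p ^ CARD('m) * ((speed p)\<^sup>2 * inverse_metric A g p (differential A f p) (differential A f p) -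
      (dir_deriv A v f p)\<^sup>2) \<partial>volume_measure A g)"
proof -
  let ?h = "cone_metric g v \<zeta>" and ?\<mu> = "volume_measure A g"
  let ?w = "\<lambda>p. 1 / speed p ^ CARD('m)" and ?a = "\<lambda>p. (dir_deriv A v f p)\<^sup>2"
  let ?b = "\<lambda>p. (speed p)\<^sup>2 * inverse_metric A g p (differential A f p) (differential A f p) - ?a p"
  note h = cone_metric_C1[OF \<zeta>]
  have f1: "Ck_map A 1 f" using Ck_map_le[OF f, of 1] by simp
  have n0: "speed p ^ CARD('m) \<noteq> 0" for p using speed_pos[of p] by simp
  have cw: "continuous_on UNIV ?w" using continuous_speed n0 by (intro continuous_intros) auto
  have ca: "continuous_on UNIV ?a" using continuous_dir_deriv[OF f1] by (intro continuous_intros)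
  have cb: "continuous_on UNIV ?b"
    using continuous_speed ca continuous_inverse_metric_differential[OF g C1_form_differential[OF f] f1]
    by (intro continuous_on_diff continuous_on_mult) (auto intro: continuous_on_power)
  have "dirichlet_form A ?h f = (\<integral>p. ?b p + ?a p / (1 - \<zeta>) \<partial>volume_measure A ?h)"
    unfolding dirichlet_form_eq[OF h f] inverse_metric_cone[OF \<zeta> f1] ..
  also have "\<dots> = (\<integral>p. sqrt (1 - \<zeta>) / speed p ^ CARD('m) * (?b p + ?a p / (1 - \<zeta>)) \<partial>?\<mu>)"
  proof (rule integral_volume_rescaled[OF h g _ _ vol_density_cone])
    show "continuous_on UNIV (\<lambda>p. sqrt (1 - \<zeta>) / speed p ^ CARD('m))"
      using continuous_speed n0 by (intro continuous_intros) auto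
    show "continuous_on UNIV (\<lambda>p. ?b p + ?a p / (1 - \<zeta>))"
      unfolding divide_inverse by (intro continuous_on_add continuous_on_mult cb ca continuous_on_const)
  qed
  also have "\<dots> = (\<integral>p. sqrt (1 - \<zeta>) * (?w p * ?b p) + sqrt (1 - \<zeta>) / (1 - \<zeta>) * (?w p * ?a p) \<partial>?\<mu>)"
    by (simp add: algebra_simps)
  also have "\<dots> = sqrt (1 - \<zeta>) * (\<integral>p. ?w p * ?b p \<partial>?\<mu>) + sqrt (1 - \<zeta>) / (1 - \<zeta>) * (\<integral>p. ?w p * ?a p \<partial>?\<mu>)"
    by (subst Bochner_Integration.integral_add)
      (simp_all only: integral_mult_right_zero integrable_mult_right
        integrable_volume_continuous[OF g continuous_on_mult[OF cw cb]]
        integrable_volume_continuous[OF g continuous_on_mult[OF cw ca]])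
  also have "(\<integral>p. ?w p * ?a p \<partial>?\<mu>) = limit_dirichlet_form A g v f"
  proof -
    have "?w \<in> borel_measurable ?\<mu>" "?a \<in> borel_measurable ?\<mu>"
      using borel_measurable_continuous_onI[OF cw] borel_measurable_continuous_onI[OF ca]
        measurable_cong_sets[OF sets_volume_measure[OF g] refl] by blast+
    then show ?thesis
      unfolding limit_dirichlet_form_def nu_bar_def using speed_pos
      by (subst integral_density) (auto simp: less_imp_le)
  qed
  also have "sqrt (1 - \<zeta>) / (1 - \<zeta>) = 1 / sqrt (1 - \<zeta>)" using \<zeta> by (simp add: real_div_sqrt field_simps)
  finally show ?thesis by simp
qed

end

section \<open>The limit \<open>\<zeta> \<rightarrow> 1\<close>\<close>

theorem mainTheorem5:
  fixes A :: "('a::{t2_space,second_countable_topology}, 'm::{finite,wellorder}) chart set"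
    and v :: "'a \<Rightarrow> ('a, 'm) tvec"
    and F :: "'a \<Rightarrow> real^'n"
    and ip :: "real^'n \<Rightarrow> real^'n \<Rightarrow> real"
    and f :: "'a \<Rightarrow> real"
  defines "g \<equiv> induced_metric A ip F"
  assumes "smooth_atlas A"
    and "compact (UNIV :: 'a set)"
    and "Ck_vector_field A 1 v"
    and "\<And>p. v p \<noteq> (\<lambda>_. 0)"
    and "is_inner_product ip"
    and "Ck_embedding A 2 F"
    and "Ck_map A 2 f"
  shows "(\<lambda>\<zeta>. dirichlet_form A (cone_metric g v \<zeta>) f
              - (1 - \<zeta>) powr (- 1 / 2) * limit_dirichlet_form A g v f)
         \<in> O[at_left 1](\<lambda>\<zeta>. (1 - \<zeta>) powr (1 / 2))"
proof -
  interpret compact_manifold A by unfold_locales (fact assms)+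
  interpret cone_kernel_setting A g v
    by unfold_locales (use assms induced_metric_C1 in \<open>simp_all add: g_def\<close>)
  define C where "C = (\<integral>p. 1 / speed p ^ CARD('m) * ((speed p)\<^sup>2 *
    inverse_metric A g p (differential A f p) (differential A f p) - (dir_deriv A v f p)\<^sup>2) \<partial>volume_measure A g)"
  have eq: "dirichlet_form A (cone_metric g v \<zeta>) f - (1 - \<zeta>) powr (- 1 / 2) * limit_dirichlet_form A g v f =
      C * (1 - \<zeta>) powr (1 / 2)" if "\<zeta> < 1" for \<zeta>
  proof -
    have "(1 - \<zeta>) powr (1 / 2) = sqrt (1 - \<zeta>)" "(1 - \<zeta>) powr (- 1 / 2) = 1 / sqrt (1 - \<zeta>)"
      using that by (simp_all add: powr_half_sqrt powr_minus_divide)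
    then show ?thesis
      unfolding dirichlet_form_cone[OF that assms(8)] C_def by simp
  qed
  have "\<forall>\<^sub>F \<zeta> in at_left 1. norm (dirichlet_form A (cone_metric g v \<zeta>) f
      - (1 - \<zeta>) powr (- 1 / 2) * limit_dirichlet_form A g v f) \<le> \<bar>C\<bar> * norm ((1 - \<zeta>) powr (1 / 2))"
  proof (rule eventually_mono[OF eventually_at_left_real[of 0 1]])
    fix \<zeta> :: real assume "\<zeta> \<in> {0<..<1}"
    then have "\<zeta> < 1" by simp
    from eq[OF this] show "norm (dirichlet_form A (cone_metric g v \<zeta>) f
        - (1 - \<zeta>) powr (- 1 / 2) * limit_dirichlet_form A g v f) \<le> \<bar>C\<bar> * norm ((1 - \<zeta>) powr (1 / 2))"
      by (simp only: real_norm_def abs_mult order_refl)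
  qed simp
  then show ?thesis by (rule bigoI)
qed

end
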